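(* A generic subshift $X$ in $\mathbf{S}'$, the derived space of $\mathbf{S}$, has the following properties: (1) $X$ is countably infinite, and there is a finite collection of periodic orbits such that every point of $X$ is bi-asymptotic to orbits in this collection; (2) $X$ has word complexity of properly superlinear and (at most) quadratic growth: $c_X(n)/n\to\infty$ as $n\to\infty$, and there exist constants $C,D,E$ with $c_X(n)\le Cn^2+Dn+E$ for all $n$. Moreover, there are subsequences along which the complexity exhibits arbitrarily slow superlinear growth: for every unbounded increasing $f:\mathbb{N}\to\mathbb{R}$, a generic subshift $X$ in $\mathbf{S}'$ satisfies $c_X(n)<nf(n)$ for infinitely many $n$.
   Context: Let $\sigma$ be the shift on $\mathbb{Z}^{\mathbb{Z}}$ (product topology, $\mathbb{Z}$ discrete), $(\sigma x)_i=x_{i+1}$. A subshift is a nonempty compact set $X\subset\mathbb{Z}^{\mathbb{Z}}$ with $\sigma(X)=X$ (automatically contained in $\mathcal{A}^{\mathbb{Z}}$ for some finite $\mathcal{A}\subset\mathbb{Z}$). $L_n(X)$ is the set of $n$-letter words occurring in points of $X$, and $c_X(n)=|L_n(X)|$. $\mathbf{S}$ is the set of all subshifts with the metric $d(X,Y)=2^{-\inf\{n\,:\,L_n(X)\ne L_n(Y)\}}$ ($d(X,X)=0$). $\mathbf{S}'$ is the set of all non-isolated points of $\mathbf{S}$, with the subspace topology. A property is generic in a space if the set of elements having it contains a dense $G_\delta$ subset of the space. A point $x$ is bi-asymptotic to orbits in a collection of periodic orbits if there are points $y,z$ in orbits of the collection with $x_i=y_i$ for all sufficiently negative $i$ and $x_i=z_i$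 for all sufficiently large $i$ ($y,z$ may be in different orbits). *)

theory Defs
  imports "HOL-Analysis.Analysis"
begin

text \<open>Topological notions on \<^typ>\<open>int \<Rightarrow> int\<close> refer to the library's instance on
  functions, i.e. the product topology, where \<^typ>\<open>int\<close> is discrete.\<close>

definition shift :: "(int \<Rightarrow> int) \<Rightarrow> (int \<Rightarrow> int)" where
  "shift x = (\<lambda>i. x (i + 1))"

definition subshift :: "(int \<Rightarrow> int) set \<Rightarrow> bool" where
  "subshift X \<longleftrightarrow> X \<noteq> {} \<and> compact X \<and> shift ` X = X"

definition words :: "nat \<Rightarrow> (int \<Rightarrow> int) set \<Rightarrow> int list set" where
  "words n X = {map (\<lambda>j. x (i + int j)) [0..<n] | x i. x \<in> X}"

definition complexity :: "(int \<Rightarrow> int) set \<Rightarrow> nat \<Rightarrow> nat" where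
  "complexity X n = card (words n X)"

definition subshift_dist :: "(int \<Rightarrow> int) set \<Rightarrow> (int \<Rightarrow> int) set \<Rightarrow> real" where
  "subshift_dist X Y =
     (if X = Y then 0 else 2 powr - real (Inf {n. words n X \<noteq> words n Y}))"

definition subshift_space :: "(int \<Rightarrow> int) set topology" where
  "subshift_space = Metric_space.mtopology {X. subshift X} subshift_dist"

definition derived_subshift_space :: "(int \<Rightarrow> int) set topology" where
  "derived_subshift_space =
     subtopology subshift_space (subshift_space derived_set_of topspace subshift_space)"

definition generic :: "'a topology \<Rightarrow> ('a \<Rightarrow> bool) \<Rightarrow> bool" where
  "generic T P \<longleftrightarrow>
     (\<exists>G. G \<subseteq> {x \<in> topspace T. P x} \<and> gdelta_in T G \<and> T closure_of G = topspace T)"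

definition orbit :: "(int \<Rightarrow> int) \<Rightarrow> (int \<Rightarrow> int) set" where
  "orbit x = {\<lambda>i. x (i + k) | k. True}"

definition periodic_orbit :: "(int \<Rightarrow> int) set \<Rightarrow> bool" where
  "periodic_orbit P \<longleftrightarrow> (\<exists>x. (\<exists>p>0. (shift ^^ p) x = x) \<and> P = orbit x)"

definition bi_asymptotic :: "(int \<Rightarrow> int) \<Rightarrow> (int \<Rightarrow> int) set set \<Rightarrow> bool" where
  "bi_asymptotic x \<P> \<longleftrightarrow>
     (\<exists>y\<in>\<Union>\<P>. \<exists>z\<in>\<Union>\<P>. (\<forall>\<^sub>F i in at_bot. x i = y i) \<and> (\<forall>\<^sub>F i in at_top. x i = z i))"

text \<open>The remaining facts show that \<^const>\<open>subshift_dist\<close> is a metric on the set of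
  subshifts, so that \<^const>\<open>subshift_space\<close> is the intended topology.\<close>

lemma subshift_translate: "subshift X \<Longrightarrow> x \<in> X \<Longrightarrow> (\<lambda>i. x (i + k)) \<in> X"
proof -
  assume X: "subshift X" and x: "x \<in> X"
  show ?thesis
  proof (induction k rule: int_induct[where k = 0])
    case base
    show ?case using x by simp
  next
    case (step1 k)
    have "shift (\<lambda>i. x (i + k)) \<in> X" using X step1 by (auto simp: subshift_def)
    thus ?case by (simp add: shift_def algebra_simps)
  next
    case (step2 k)
    then obtain y where y: "y \<in> X" "shift y = (\<lambda>i. x (i + k))"
      using X by (metis subshift_def imageE)
    have "y i = x (i + (k - 1))" for i
      using fun_cong[OF y(2), of "i - 1"] by (simp add: shift_def algebra_simps)
    hence "y = (\<lambda>i. x (i + (k - 1)))" by auto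
    thus ?case using y(1) by simp
  qed
qed

lemma subshift_subset_if_words_eq:
  assumes X: "subshift X" and Y: "subshift Y" and eq: "\<And>n. words n X = words n Y"
  shows "X \<subseteq> Y"
proof (rule subsetI, rule ccontr)
  fix x assume x: "x \<in> X" "x \<notin> Y"
  have "Hausdorff_space (euclidean :: int topology)"
    unfolding Hausdorff_space_def disjnt_def by (simp add: separation_t2)
  hence "Hausdorff_space (euclidean :: (int \<Rightarrow> int) topology)"
    unfolding euclidean_product_topology[symmetric]
    by (simp add: Hausdorff_space_product_topology)
  moreover have "compactin euclidean Y" using Y by (simp add: subshift_def)
  ultimately have "closedin euclidean Y" by (rule compactin_imp_closedin)
  hence "closed Y" by simp
  hence "openin (product_topology (\<lambda>i::int. euclidean :: int topology) UNIV) (- Y)"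
    by (metis open_Compl open_fun_def)
  from product_topology_open_contains_basis[OF this, of x] x(2) obtain U where
    U: "x \<in> (\<Pi>\<^sub>E i\<in>UNIV. U i)" "finite {i. U i \<noteq> UNIV}" "(\<Pi>\<^sub>E i\<in>UNIV. U i) \<subseteq> - Y"
    by auto
  obtain m :: int where m: "\<And>i. U i \<noteq> UNIV \<Longrightarrow> \<bar>i\<bar> \<le> m"
  proof -
    have "finite (abs ` {i. U i \<noteq> UNIV})" using U(2) by simp
    then obtain m where "\<forall>k\<in>abs ` {i. U i \<noteq> UNIV}. k \<le> m"
      by (meson bdd_above.E bdd_above_finite)
    thus ?thesis using that by auto
  qed
  define n where "n = nat (2 * m + 1)"
  have "map (\<lambda>j. x (- m + int j)) [0..<n] \<in> words n X"
    unfolding words_def using x(1) by blast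
  then obtain y k where y: "y \<in> Y"
    and w: "map (\<lambda>j. x (- m + int j)) [0..<n] = map (\<lambda>j. y (k + int j)) [0..<n]"
    unfolding eq by (auto simp: words_def)
  define z where "z = (\<lambda>i. y (i + (k + m)))"
  have z: "z \<in> Y" unfolding z_def by (rule subshift_translate[OF Y y])
  have "z i \<in> U i" for i
  proof (cases "U i = UNIV")
    case False
    hence i: "\<bar>i\<bar> \<le> m" by (rule m)
    hence j: "nat (i + m) < n" by (auto simp: n_def)
    have "x (- m + int (nat (i + m))) = y (k + int (nat (i + m)))"
      using arg_cong[OF w, of "\<lambda>v. v ! nat (i + m)"] j by (simp del: int_nat_eq)
    moreover have "0 \<le> i + m" using i by linarith
    ultimately have "x i = z i" by (simp add: z_def algebra_simps)
    thus ?thesis using U(1) by (metis PiE_E UNIV_I)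
  qed simp
  hence "z \<in> - Y" using U(3) by (auto simp: PiE_def extensional_def Pi_def)
  thus False using z by simp
qed

lemma Metric_space_subshift_dist: "Metric_space {X. subshift X} subshift_dist"
proof
  show "0 \<le> subshift_dist X Y" for X Y by (simp add: subshift_dist_def)
  show "subshift_dist X Y = subshift_dist Y X" for X Y
    unfolding subshift_dist_def eq_commute[of X Y] eq_commute[of "words _ X" "words _ Y"] ..
  show "subshift_dist X Y = 0 \<longleftrightarrow> X = Y" for X Y by (simp add: subshift_dist_def)
next
  fix X Y Z :: "(int \<Rightarrow> int) set"
  assume S: "X \<in> {X. subshift X}" "Y \<in> {X. subshift X}" "Z \<in> {X. subshift X}"
  show "subshift_dist X Z \<le> subshift_dist X Y + subshift_dist Y Z"
  proof (cases "X = Y \<or> Y = Z \<or> X = Z")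
    case True
    thus ?thesis by (auto simp: subshift_dist_def)
  next
    case False
    define D where "D = (\<lambda>A B. {n. words n A \<noteq> words n B})"
    have "D X Z \<noteq> {}"
      using S False subshift_subset_if_words_eq[of X Z] subshift_subset_if_words_eq[of Z X]
      by (auto simp: D_def)
    hence "Inf (D X Z) \<in> D X Z" by (rule Inf_nat_def1)
    hence "Inf (D X Z) \<in> D X Y \<or> Inf (D X Z) \<in> D Y Z" by (auto simp: D_def)
    hence "Inf (D X Y) \<le> Inf (D X Z) \<or> Inf (D Y Z) \<le> Inf (D X Z)"
      by (meson cInf_lower bdd_below_bot)
    hence "2 powr - real (Inf (D X Z)) \<le> 2 powr - real (Inf (D X Y)) \<or>
      2 powr - real (Inf (D X Z)) \<le> 2 powr - real (Inf (D Y Z))"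
      by auto
    hence "2 powr - real (Inf (D X Z)) \<le>
        2 powr - real (Inf (D X Y)) + 2 powr - real (Inf (D Y Z))"
      by (smt (verit) powr_ge_zero)
    thus ?thesis using False by (simp add: subshift_dist_def D_def)
  qed
qed

end

theory Submission
  imports Defs
begin

text \<open>Two subshifts are close when they have the same words of some large length \<open>n\<close>. Let \<open>X\<close> be
  non-isolated and consider all sequences whose words of length \<open>n\<close> occur in \<open>X\<close>, a shift of finite
  type, with its words preordered by reachability. Were it a union of finitely many orbits, only
  finitely many subshifts would have the same words of length \<open>n\<close> as \<open>X\<close>, and \<open>X\<close> would be isolated.
  Since it is not, either some periodic point runs through words that are neither minimal nor
  maximal, or some word lies on two periodic points, and then on infinitely many
  (\<open>finitely_many_orbits\<close>, \<open>infinitely_many_cyclic\<close>). In both cases there is a chain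
  \<open>a \<rightarrow> b \<rightarrow> c\<close> of three distinct periodic orbits, linked by a transition \<open>u\<close> from \<open>a\<close> to \<open>b\<close> and a
  transition \<open>v\<close> from \<open>b\<close> to \<open>c\<close>. All words of \<open>X\<close> of length \<open>n\<close> can be covered by \<^emph>\<open>source\<close> orbits,
  which run through minimal words, and by transitions from source orbits to \<^emph>\<open>sink\<close> orbits, which
  run through maximal words. The chain can be chosen so that \<open>a\<close> is a source, \<open>b\<close> is neither a source
  nor a sink, and \<open>c\<close> is a sink or a new orbit, which then counts as one more sink
  (\<open>skeleton_exists\<close>).

  For a set \<open>K\<close> of periods of \<open>b\<close> let \<open>bridged K\<close> consist of these periodic orbits, these transitions
  and, for every \<open>g \<in> K\<close>, the orbit of the point \<open>bridge g\<close> that follows \<open>u\<close>, stays with \<open>b\<close> for the time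
  \<open>g\<close> and then follows \<open>v\<close>. It has the same words of length \<open>n\<close> as \<open>X\<close>. Because sources are never
  entered, sinks are never left, and only \<open>b\<close> is both entered and left, three things hold.

  \<^item> With all periods of \<open>b\<close> allowed, \<open>bridged gaps\<close> is a shift of finite type
    (\<open>bridged_finite_type\<close>). A subshift close to \<open>bridged K\<close> is therefore contained in it, hence
    countable, bi-asymptotic to finitely many periodic orbits, and of at most quadratic complexity:
    at most \<open>n\<close> of the points \<open>bridge g\<close> have \<open>g < n\<close>, and each of them has at most \<open>n\<close> words of
    length \<open>n\<close> that are not words of \<open>u\<close> or \<open>v\<close> (\<open>complexity_bridged_le\<close>).
  \<^item> Each \<open>bridge g\<close> is isolated in \<open>bridged gaps\<close>, so a subshift close to \<open>bridged K\<close> contains any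
    prescribed finite number of the points \<open>bridge g\<close> with \<open>g \<in> K\<close>, and each of them contributes
    \<open>n - c\<close> words of length \<open>n\<close> for some constant \<open>c\<close> (\<open>nearby_superlinear\<close>).
  \<^item> If \<open>K\<close> is infinite, \<open>bridged K\<close> is non-isolated, because dropping large elements of \<open>K\<close> does not
    change the short words. If \<open>K\<close> is sparse, the complexity of \<open>bridged K\<close> is below \<open>n f n\<close> for
    infinitely many \<open>n\<close> (\<open>sparse_bridges\<close>).

  Hence the subshifts \<open>bridged K\<close> with \<open>K\<close> infinite are dense in the derived space. For every \<open>k\<close> all
  of them have a neighbourhood in which the properties of the first item hold and the complexity is
  at least \<open>k (n - c)\<close> for a constant \<open>c\<close>, and those with sparse \<open>K\<close> have a neighbourhood in which the
  complexity is below \<open>n f n\<close> for some \<open>n \<ge> k\<close>.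
  For each \<open>k\<close> such neighbourhoods form an open set, and the intersection of these open sets over all
  \<open>k\<close> contains a dense set (\<open>generic_derivedI\<close>).\<close>

section \<open>Windows, translates and compactness\<close>

definition translate :: "int \<Rightarrow> (int \<Rightarrow> int) \<Rightarrow> int \<Rightarrow> int" where
  "translate k x = (\<lambda>i. x (i + k))"

definition window :: "nat \<Rightarrow> (int \<Rightarrow> int) \<Rightarrow> int \<Rightarrow> int list" where
  "window n x i = map (\<lambda>j. x (i + int j)) [0..<n]"

lemma translate_apply [simp]: "translate k x i = x (i + k)"
  by (simp add: translate_def)

lemma translate_translate [simp]: "translate j (translate k x) = translate (j + k) x"
  by (simp add: translate_def algebra_simps)

lemma translate_0 [simp]: "translate 0 x = x"
  by (simp add: translate_def)

lemma orbit_eq_range: "orbit x = range (\<lambda>k. translate k x)"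
  by (auto simp: orbit_def translate_def)

lemma orbit_self [simp]: "x \<in> orbit x"
  unfolding orbit_eq_range by (metis rangeI translate_0)

lemma orbit_translate: "y \<in> orbit x \<Longrightarrow> translate k y \<in> orbit x"
  by (auto simp: orbit_eq_range)

lemma orbit_sym: "y \<in> orbit x \<Longrightarrow> x \<in> orbit y"
  unfolding orbit_eq_range
  by (metis (no_types, lifting) add.left_inverse imageE rangeI translate_0 translate_translate)

lemma shift_funpow: "(shift ^^ k) x = translate (int k) x"
  by (induction k) (auto simp: shift_def translate_def algebra_simps)

lemma window_eq_iff:
  "window n x i = window n y j \<longleftrightarrow> (\<forall>l. 0 \<le> l \<and> l < int n \<longrightarrow> x (i + l) = y (j + l))"
proof
  assume eq: "window n x i = window n y j"
  show "\<forall>l. 0 \<le> l \<and> l < int n \<longrightarrow> x (i + l) = y (j + l)"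
  proof (intro allI impI)
    fix l assume l: "0 \<le> l \<and> l < int n"
    then show "x (i + l) = y (j + l)"
      using arg_cong[OF eq, of "\<lambda>w. w ! nat l"] by (simp add: window_def nat_less_iff)
  qed
qed (auto simp: window_def)

lemma window_eqD:
  assumes "window n x i = window n y j" "i \<le> l" "l < i + int n"
  shows "x l = y (l - i + j)"
  using assms(1)[unfolded window_eq_iff, rule_format, of "l - i"] assms(2,3)
  by (simp add: algebra_simps)

lemma window_eqI:
  assumes "\<And>l. i \<le> l \<Longrightarrow> l < i + int n \<Longrightarrow> x l = y (l - i + j)"
  shows "window n x i = window n y j"
  unfolding window_eq_iff
proof (intro allI impI)
  fix l assume "0 \<le> l \<and> l < int n"
  then show "x (i + l) = y (j + l)"
    using assms[of "i + l"] by (simp add: algebra_simps)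
qed

lemma window_translate [simp]: "window n (translate k x) i = window n x (i + k)"
  by (simp add: window_eq_iff algebra_simps)

lemma words_alt: "words n X = {window n x i | x i. x \<in> X}"
  by (simp add: words_def window_def)

lemma window_in_words: "x \<in> X \<Longrightarrow> window n x i \<in> words n X"
  by (auto simp: words_alt)

lemma words_mono: "X \<subseteq> Y \<Longrightarrow> words n X \<subseteq> words n Y"
  by (auto simp: words_alt)

lemma words_prefix:
  assumes "m \<le> n" shows "words m X = take m ` words n X"
proof -
  have "take m (window n x i) = window m x i" for x i
    using assms by (simp add: window_def take_map)
  then show ?thesis
    unfolding words_alt by (force simp: image_iff)
qed

lemma words_eq_shorter: "words n X = words n Y \<Longrightarrow> m \<le> n \<Longrightarrow> words m X = words m Y"
  by (simp add: words_prefix)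

lemma translate_in_subshift: "subshift X \<Longrightarrow> x \<in> X \<Longrightarrow> translate k x \<in> X"
  using subshift_translate by (simp add: translate_def)

lemma words_subshift:
  assumes "subshift X" shows "words n X = (\<lambda>x. window n x 0) ` X"
proof -
  have "window n x i = window n (translate i x) 0" for x i by simp
  then show ?thesis
    unfolding words_alt using translate_in_subshift[OF assms] by blast
qed

lemma word_occurs_at:
  assumes "subshift X" "w \<in> words n X" obtains x where "x \<in> X" "window n x i = w"
proof -
  obtain x j where "x \<in> X" "w = window n x j" using assms(2) by (auto simp: words_alt)
  then have "translate (j - i) x \<in> X" "window n (translate (j - i) x) i = w"
    using translate_in_subshift[OF assms(1)] by auto
  then show ?thesis using that by blast
qed

lemma finite_alphabet:
  assumes "subshift X" obtains A where "finite A" "\<And>x i. x \<in> X \<Longrightarrow> x i \<in> A"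
proof -
  have "continuous_on X (\<lambda>x. x 0)"
    by (rule continuous_on_subset[OF continuous_on_product_coordinates]) simp
  then have "compact ((\<lambda>x. x 0) ` X)"
    using assms compact_continuous_image by (auto simp: subshift_def)
  then obtain C where "C \<subseteq> (\<lambda>x. x 0) ` X" "finite C" "(\<lambda>x. x 0) ` X \<subseteq> (\<Union>c\<in>C. {c})"
    using compactE_image[of "(\<lambda>x. x 0) ` X" "(\<lambda>x. x 0) ` X" "\<lambda>c. {c}"]
    by (metis UN_singleton open_discrete order_refl)
  then have fin: "finite ((\<lambda>x. x 0) ` X)"
    using finite_subset by auto
  have "x i \<in> (\<lambda>x. x 0) ` X" if "x \<in> X" for x i
    using translate_in_subshift[OF assms that, of i]
    by (intro image_eqI[of _ _ "translate i x"]) simp_all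
  then show ?thesis using fin that by blast
qed

lemma finite_words: assumes "subshift X" shows "finite (words n X)"
proof -
  obtain A where A: "finite A" "\<And>x i. x \<in> X \<Longrightarrow> x i \<in> A"
    using finite_alphabet[OF assms] by metis
  have "words n X \<subseteq> {w. set w \<subseteq> A \<and> length w = n}"
    using A(2) by (auto simp: words_alt window_def)
  then show ?thesis using finite_lists_length_eq[OF A(1)] finite_subset by blast
qed

text \<open>The last condition says that \<open>X\<close> is closed in the product topology; over a finite alphabet it is
  then a closed part of a compact product.\<close>

lemma subshiftI:
  assumes "X \<noteq> {}" "finite A" "\<And>x i. x \<in> X \<Longrightarrow> x i \<in> A"
    and inv: "\<And>x k. x \<in> X \<Longrightarrow> translate k x \<in> X"
    and approx: "\<And>y. (\<And>N. \<exists>x\<in>X. \<forall>i. \<bar>i\<bar> \<le> N \<longrightarrow> x i = y i) \<Longrightarrow> y \<in> X"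
  shows "subshift X"
proof -
  have "open (- X)"
    unfolding open_subopen[of "- X"]
  proof
    fix y assume "y \<in> - X"
    then obtain N where N: "\<And>x. x \<in> X \<Longrightarrow> \<exists>i. \<bar>i\<bar> \<le> N \<and> x i \<noteq> y i"
      using approx[of y] by (metis ComplD)
    let ?U = "\<Inter>i\<in>{-N..N}. (\<lambda>x::int \<Rightarrow> int. x i) -` {y i}"
    have "open ?U"
      by (intro open_INT ballI open_vimage open_discrete continuous_on_product_coordinates) auto
    moreover have "y \<in> ?U" by auto
    moreover have "?U \<subseteq> - X" using N by fastforce
    ultimately show "\<exists>T. open T \<and> y \<in> T \<and> T \<subseteq> - X" by blast
  qed
  then have "closed X" by (simp add: closed_def)
  moreover have "compact (\<Pi>\<^sub>E i\<in>(UNIV::int set). A)"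
  proof -
    have "compactin (product_topology (\<lambda>i::int. euclidean) UNIV) (\<Pi>\<^sub>E i\<in>UNIV. A)"
      using assms(2) by (simp add: compactin_PiE finite_imp_compact)
    then show ?thesis by (simp add: euclidean_product_topology)
  qed
  moreover have "X \<subseteq> (\<Pi>\<^sub>E i\<in>(UNIV::int set). A)" using assms(3) by auto
  ultimately have "compact X"
    by (metis compact_Int_closed inf.absorb_iff2)
  moreover have "shift ` X = X"
  proof -
    have s: "shift x = translate 1 x" for x by (simp add: shift_def translate_def)
    have "x \<in> shift ` X" if "x \<in> X" for x
    proof (rule image_eqI)
      show "x = shift (translate (-1) x)" by (simp add: s)
    qed (use inv that in simp)
    then show ?thesis using inv s by auto
  qed
  ultimately show ?thesis using assms(1) by (simp add: subshift_def)
qed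

section \<open>The space of subshifts and its derived space\<close>

interpretation subshifts: Metric_space "{X. subshift X}" subshift_dist
  by (rule Metric_space_subshift_dist)

lemma topspace_subshift_space [simp]: "topspace subshift_space = {X. subshift X}"
  by (simp add: subshift_space_def)

text \<open>Long words determine short ones, so the sets of words of \<open>X\<close> and \<open>Y\<close> agree up to some length and
  differ from then on.\<close>

lemma subshift_dist_less_iff:
  assumes "subshift X" "subshift Y"
  shows "subshift_dist X Y < 2 powr - real n \<longleftrightarrow> words n X = words n Y"
proof (cases "X = Y")
  case True
  then show ?thesis by (simp add: subshift_dist_def)
next
  case False
  define D where "D = {n. words n X \<noteq> words n Y}"
  have "D \<noteq> {}"
    using False assms subshift_subset_if_words_eq[of X Y] subshift_subset_if_words_eq[of Y X]
    by (auto simp: D_def)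
  then have least: "Inf D \<in> D" by (rule Inf_nat_def1)
  have "n < Inf D \<longleftrightarrow> words n X = words n Y"
  proof
    assume "n < Inf D"
    then have "n \<notin> D" using cInf_lower[of n D] by fastforce
    then show "words n X = words n Y" by (simp add: D_def)
  next
    assume "words n X = words n Y"
    then have "words m X = words m Y" if "m \<le> n" for m
      by (rule words_eq_shorter) (rule that)
    then have "m \<notin> D" if "m \<le> n" for m
      using that by (simp add: D_def)
    then show "n < Inf D" using least not_le by blast
  qed
  moreover have "subshift_dist X Y = 2 powr - real (Inf D)"
    using False by (simp add: subshift_dist_def D_def)
  ultimately show ?thesis by simp
qed

text \<open>The subshifts with prescribed words of one length form a base of the topology.\<close>

lemma openin_subshift_space_iff:
  "openin subshift_space U \<longleftrightarrow> U \<subseteq> Collect subshift \<and>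
    (\<forall>X\<in>U. \<exists>n. \<forall>Y. subshift Y \<and> words n Y = words n X \<longrightarrow> Y \<in> U)"
proof -
  have ball: "Y \<in> subshifts.mball X r \<longleftrightarrow> subshift X \<and> subshift Y \<and> subshift_dist X Y < r" for X Y r
    unfolding subshifts.in_mball by blast
  have "(\<exists>r>0. subshifts.mball X r \<subseteq> U) \<longleftrightarrow>
      (\<exists>n. \<forall>Y. subshift Y \<and> words n Y = words n X \<longrightarrow> Y \<in> U)" (is "?L \<longleftrightarrow> ?R")
    if X: "subshift X" for X
  proof
    assume ?L
    then obtain r where r: "r > 0" "subshifts.mball X r \<subseteq> U" by blast
    obtain n where "(1/2) ^ n < r"
      using real_arch_pow_inv[OF r(1), of "1/2"] by auto
    moreover have "2 powr - real n = (1/2) ^ n"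
      by (simp add: powr_minus powr_realpow power_divide field_simps)
    ultimately have "Y \<in> U" if Y: "subshift Y" "words n Y = words n X" for Y
      using subshift_dist_less_iff[OF X Y(1), of n] r(2) ball[of Y X r] X Y by fastforce
    then show ?R by blast
  next
    assume ?R
    then obtain n where n: "\<And>Y. subshift Y \<Longrightarrow> words n Y = words n X \<Longrightarrow> Y \<in> U" by blast
    have "subshifts.mball X (2 powr - real n) \<subseteq> U"
      using n subshift_dist_less_iff[OF X] ball by (metis subsetI)
    moreover have "(2::real) powr - real n > 0" by simp
    ultimately show ?L by blast
  qed
  then show ?thesis
    unfolding subshift_space_def subshifts.openin_mtopology by blast
qed

lemma openin_words: "openin subshift_space {X. subshift X \<and> Q (words n X)}"
  unfolding openin_subshift_space_iff by (auto intro!: exI[of _ n])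

lemma subshift_space_nbhd:
  assumes "openin subshift_space U" "X \<in> U"
  obtains n where "\<And>Y. subshift Y \<Longrightarrow> words n Y = words n X \<Longrightarrow> Y \<in> U"
  using assms unfolding openin_subshift_space_iff by blast

abbreviation nonisolated :: "(int \<Rightarrow> int) set set" where
  "nonisolated \<equiv> subshift_space derived_set_of topspace subshift_space"

lemma nonisolated_subshift: "X \<in> nonisolated \<Longrightarrow> subshift X"
  by (simp add: in_derived_set_of)

lemma nonisolatedI:
  assumes "subshift X" "\<And>n. \<exists>Y. subshift Y \<and> words n Y = words n X \<and> Y \<noteq> X"
  shows "X \<in> nonisolated"
  unfolding in_derived_set_of
  using assms subshift_space_nbhd by (metis (mono_tags, lifting) mem_Collect_eq topspace_subshift_space)

text \<open>A neighbourhood of a limit point of a metric space contains infinitely many points.\<close>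

lemma nonisolated_infinite:
  assumes "X \<in> nonisolated" shows "infinite {Y. subshift Y \<and> words n Y = words n X}"
proof -
  have "t1_space subshift_space"
    by (simp add: subshift_space_def subshifts.t1_space_mtopology)
  then have "infinite (topspace subshift_space \<inter> {Y. subshift Y \<and> words n Y = words n X})"
    using assms openin_words[of "\<lambda>w. w = words n X" n]
    by (auto simp: t1_space_derived_set_of_infinite_openin)
  then show ?thesis by (simp add: Int_def)
qed

text \<open>The \<open>G\<^sub>\<delta>\<close> set is the intersection over \<open>k\<close> of the interiors of \<open>Q k\<close>. The assumption asks for a dense
  set of points that lie in all these interiors at once, so that the intersection is dense at sight.\<close>

lemma generic_derivedI:
  assumes dense: "\<And>X n. X \<in> nonisolated \<Longrightarrow>
      \<exists>Y\<in>nonisolated. words n Y = words n X \<and>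
        (\<forall>k::nat. \<exists>m. \<forall>Z\<in>nonisolated. words m Z = words m Y \<longrightarrow> Q k Z)"
    and imp: "\<And>Z. Z \<in> nonisolated \<Longrightarrow> (\<And>k. Q k Z) \<Longrightarrow> R Z"
  shows "generic derived_subshift_space R"
proof -
  let ?T = derived_subshift_space
  have top: "topspace ?T = nonisolated"
    by (auto simp: derived_subshift_space_def in_derived_set_of)
  define V where "V k = {Y\<in>nonisolated. \<exists>m. \<forall>Z\<in>nonisolated. words m Z = words m Y \<longrightarrow> Q k Z}" for k
  have "openin ?T (V k)" for k
  proof -
    define U where "U m = {Y. subshift Y \<and> (\<forall>Z\<in>nonisolated. words m Z = words m Y \<longrightarrow> Q k Z)}" for m
    have "openin subshift_space (U m)" for m
      unfolding U_def by (rule openin_words)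
    then have "openin subshift_space (\<Union>m. U m)" by blast
    moreover have "V k = (\<Union>m. U m) \<inter> nonisolated"
      using nonisolated_subshift by (auto simp: V_def U_def)
    ultimately show ?thesis
      unfolding derived_subshift_space_def openin_subtopology by blast
  qed
  then have "gdelta_in ?T (\<Inter>(range V))"
    by (intro gdelta_in_Inter) (auto intro: open_imp_gdelta_in)
  moreover have "\<Inter>(range V) \<subseteq> {x \<in> topspace ?T. R x}"
    using imp by (auto simp: V_def top)
  moreover have "?T closure_of (\<Inter>(range V)) = topspace ?T"
  proof (intro equalityI closure_of_subset_topspace subsetI)
    fix X assume X: "X \<in> topspace ?T"
    have "\<exists>Y\<in>\<Inter>(range V). Y \<in> U" if U: "X \<in> U" "openin ?T U" for U
    proof -
      obtain U' where U': "openin subshift_space U'" "U = U' \<inter> nonisolated"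
        using U(2) by (auto simp: derived_subshift_space_def openin_subtopology)
      then obtain n where n: "\<And>Y. subshift Y \<Longrightarrow> words n Y = words n X \<Longrightarrow> Y \<in> U'"
        using subshift_space_nbhd U(1) by (metis IntE)
      obtain Y where "Y \<in> nonisolated" "words n Y = words n X"
        "\<forall>k. \<exists>m. \<forall>Z\<in>nonisolated. words m Z = words m Y \<longrightarrow> Q k Z"
        using dense X top by metis
      then show ?thesis using n U'(2) nonisolated_subshift by (auto simp: V_def intro!: bexI[of _ Y])
    qed
    then show "X \<in> ?T closure_of (\<Inter>(range V))"
      unfolding in_closure_of using X by blast
  qed
  ultimately show ?thesis unfolding generic_def by blast
qed

section \<open>Skeletons and bridged subshifts\<close>

lemma periodic_mult:
  fixes p :: "int \<Rightarrow> 'a"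
  assumes "\<And>i. p (i + q) = p i" shows "p (i + k * q) = p i"
proof (induction k rule: int_induct[where k = 0])
  case (step1 k) then show ?case using assms[of "i + k * q"] by (simp add: algebra_simps)
next
  case (step2 k) then show ?case using assms[of "i + (k - 1) * q"] by (simp add: algebra_simps)
qed simp

lemma periodic_mod:
  fixes p :: "int \<Rightarrow> 'a"
  assumes "\<And>i. p (i + q) = p i" shows "p (j + (i - j) mod q) = p i"
proof -
  have "p (i + (- ((i - j) div q)) * q) = p i" by (rule periodic_mult) (rule assms)
  moreover have "i + (- ((i - j) div q)) * q = j + (i - j) mod q"
    by (simp add: algebra_simps minus_mult_div_eq_mod[symmetric])
  ultimately show ?thesis by simp
qed

lemma periodic_eqI:
  fixes p :: "int \<Rightarrow> 'a"
  assumes "\<And>i. p (i + q) = p i" "\<And>i. p' (i + q) = p' i" "q > 0"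
    and eq: "\<And>i. j \<le> i \<Longrightarrow> i < j + q \<Longrightarrow> p i = p' i"
  shows "p = p'"
proof
  fix i
  have "p (j + (i - j) mod q) = p' (j + (i - j) mod q)"
    using assms(3) by (intro eq) auto
  then show "p i = p' i"
    by (simp only: periodic_mod[where p = p, OF assms(1)] periodic_mod[where p = p', OF assms(2)])
qed

lemma finite_orbit_periodic:
  assumes "\<And>i. p (i + q) = p i" "q > 0" shows "finite (orbit p)"
proof -
  have "translate k p = translate (k mod q) p" for k
  proof
    fix i show "translate k p i = translate (k mod q) p i"
      using periodic_mod[of p q i "i + k"] assms(1) by (simp add: add.commute)
  qed
  then have "orbit p \<subseteq> (\<lambda>k. translate k p) ` {0..<q}"
    unfolding orbit_eq_range using assms(2)
    by (auto intro!: image_eqI[of _ _ "_ mod q"])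
  then show ?thesis using finite_subset by blast
qed

text \<open>\<open>S\<close> and \<open>E\<close> are the points of the source and the sink orbits, and \<open>T\<close> contains transitions from sources
  to sinks. The transitions \<open>u\<close> and \<open>v\<close> are positioned so that \<open>u\<close> has reached \<open>b\<close> by time \<open>0\<close> and \<open>v\<close> leaves
  it at the earliest at time \<open>0\<close>. A transition of any kind lasts at most \<open>l\<close>, and \<open>q\<close> is a common
  period. As \<open>S\<close>, \<open>E\<close> and the orbit of \<open>b\<close> are disjoint, no chain of transitions visits more than three
  of the periodic orbits.\<close>

locale skeleton =
  fixes S E T :: "(int \<Rightarrow> int) set" and b u v :: "int \<Rightarrow> int" and q l :: int
  assumes finite_S: "finite S" and finite_E: "finite E" and finite_T: "finite T"
    and q_pos: "q > 0" and l_nonneg: "l \<ge> 0"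
    and periodic: "p \<in> S \<union> E \<union> {b} \<Longrightarrow> p (i + q) = p i"
    and S_inv: "p \<in> S \<Longrightarrow> translate k p \<in> S"
    and E_inv: "p \<in> E \<Longrightarrow> translate k p \<in> E"
    and S_E_disjoint: "S \<inter> E = {}" and b_notin: "b \<notin> S \<union> E"
    and T_left: "t \<in> T \<Longrightarrow> \<exists>p\<in>S. \<forall>i<0. t i = p i"
    and T_right: "t \<in> T \<Longrightarrow> \<exists>p\<in>E. \<forall>i\<ge>l. t i = p i"
    and u_left: "\<exists>p\<in>S. \<forall>i< -l. u i = p i"
    and u_right: "i \<ge> 0 \<Longrightarrow> u i = b i"
    and v_left: "i < 0 \<Longrightarrow> v i = b i"
    and v_right: "\<exists>p\<in>E. \<forall>i\<ge>l. v i = p i"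
begin

definition P :: "(int \<Rightarrow> int) set" where "P = S \<union> E \<union> orbit b"

text \<open>Only if the stay with \<open>b\<close> lasts for one of its periods is the phase of \<open>b\<close> right for a departure along \<open>v\<close>.\<close>

definition gaps :: "nat set" where "gaps = {g. translate (int g) b = b}"

definition bridge :: "nat \<Rightarrow> int \<Rightarrow> int" where
  "bridge g i = (if i < int g then u i else v (i - int g))"

definition bridged :: "nat set \<Rightarrow> (int \<Rightarrow> int) set" where
  "bridged K = P \<union> \<Union>(orbit ` (insert u (insert v T))) \<union> \<Union>(orbit ` bridge ` K)"

lemma P_periodic: "p \<in> P \<Longrightarrow> p (i + q) = p i"
  using periodic[of p i] periodic[of b "i + _"]
  by (auto simp: P_def orbit_eq_range) (metis add.assoc add.commute)

lemma P_inv: "p \<in> P \<Longrightarrow> translate k p \<in> P"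
  using S_inv E_inv orbit_translate by (auto simp: P_def)

lemma P_eqI:
  assumes "p \<in> P" "p' \<in> P" "\<And>i. j \<le> i \<Longrightarrow> i < j + q \<Longrightarrow> p i = p' i"
  shows "p = p'"
  by (rule periodic_eqI[where q = q and j = j]) (use assms P_periodic q_pos in auto)

lemma finite_P: "finite P"
proof -
  have "finite (orbit b)"
    by (rule finite_orbit_periodic[where q = q]) (use periodic q_pos in auto)
  then show ?thesis by (simp add: P_def finite_S finite_E)
qed

lemma S_not: "p \<in> S \<Longrightarrow> p \<notin> E \<and> p \<notin> orbit b"
  and E_not: "p \<in> E \<Longrightarrow> p \<notin> S \<and> p \<notin> orbit b"
proof -
  have "b \<in> S" if "p \<in> S" "p \<in> orbit b"
    using orbit_sym[OF that(2)] S_inv[OF that(1)] by (auto simp: orbit_eq_range)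
  moreover have "b \<in> E" if "p \<in> E" "p \<in> orbit b"
    using orbit_sym[OF that(2)] E_inv[OF that(1)] by (auto simp: orbit_eq_range)
  ultimately show "p \<in> S \<Longrightarrow> p \<notin> E \<and> p \<notin> orbit b" "p \<in> E \<Longrightarrow> p \<notin> S \<and> p \<notin> orbit b"
    using S_E_disjoint b_notin by blast+
qed

lemma translate_S_iff: "translate k p \<in> S \<longleftrightarrow> p \<in> S"
  using S_inv[of p k] S_inv[of "translate k p" "-k"] by auto

lemma translate_E_iff: "translate k p \<in> E \<longleftrightarrow> p \<in> E"
  using E_inv[of p k] E_inv[of "translate k p" "-k"] by auto

lemma translate_orbit_iff: "translate k p \<in> orbit x \<longleftrightarrow> p \<in> orbit x"
  using orbit_translate[of p x k] orbit_translate[of "translate k p" x "-k"] by auto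

lemma b_gap:
  assumes "g \<in> gaps" shows "b (i - int g) = b i"
proof -
  have "translate (int g) b (i - int g) = b (i - int g)"
    using assms by (simp only: gaps_def mem_Collect_eq)
  then show ?thesis by simp
qed

lemma gaps_unbounded: "\<exists>g\<in>gaps. N < g"
proof -
  have "b (i + int (nat q * Suc N)) = b i" for i
  proof -
    have "b (i + int (Suc N) * q) = b i"
      by (rule periodic_mult) (use periodic in auto)
    moreover have "int (Suc N) * q = int (nat q * Suc N)" using q_pos by (simp add: algebra_simps)
    ultimately show ?thesis by metis
  qed
  then have "nat q * Suc N \<in> gaps" by (auto simp: gaps_def)
  moreover have "N < nat q * Suc N"
    using q_pos by (metis Suc_le_eq less_le_trans lessI mult.commute mult_le_mono2 nat_mult_1_right zero_less_nat_eq One_nat_def)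
  ultimately show ?thesis by blast
qed

lemma bridge_left: "i < int g \<Longrightarrow> bridge g i = u i"
  by (simp add: bridge_def)

text \<open>On \<open>[0, g)\<close> both \<open>u\<close> and the delayed \<open>v\<close> agree with \<open>b\<close>, so \<open>bridge g\<close> follows the delayed \<open>v\<close> already from
  time \<open>0\<close>.\<close>

lemma bridge_right: "g \<in> gaps \<Longrightarrow> i \<ge> 0 \<Longrightarrow> bridge g i = v (i - int g)"
  using u_right v_left b_gap by (simp add: bridge_def)

lemma bridge_mid: "0 \<le> i \<Longrightarrow> i < int g \<Longrightarrow> bridge g i = b i"
  using u_right by (simp add: bridge_def)

lemma bridged_cases:
  assumes "y \<in> bridged K"
  obtains "y \<in> P" | t k where "t \<in> insert u (insert v T)" "y = translate k t"
  | g k where "g \<in> K" "y = translate k (bridge g)"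
  using assms unfolding bridged_def orbit_eq_range by blast

lemma P_subset_bridged: "P \<subseteq> bridged K"
  by (auto simp: bridged_def)

lemma orbit_subset_bridged:
  "t \<in> insert u (insert v T) \<Longrightarrow> translate k t \<in> bridged K"
  "g \<in> K \<Longrightarrow> translate k (bridge g) \<in> bridged K"
  unfolding bridged_def orbit_eq_range by blast+

lemma bridge_in_bridged: "g \<in> K \<Longrightarrow> bridge g \<in> bridged K"
  using orbit_subset_bridged(2)[of g K 0] by simp

lemma bridged_inv: "y \<in> bridged K \<Longrightarrow> translate k y \<in> bridged K"
  by (erule bridged_cases) (use P_inv P_subset_bridged orbit_subset_bridged in auto)

lemma bridged_mono: "K \<subseteq> K' \<Longrightarrow> bridged K \<subseteq> bridged K'"
  by (auto simp: bridged_def)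

section \<open>Regular positions\<close>

text \<open>At a regular position \<open>j\<close> the point \<open>y\<close> runs along the periodic point \<open>p\<close> for a full period, and the
  part of the skeleton to which \<open>p\<close> belongs decides where \<open>y\<close> comes from and where it goes: it has
  always been at a source, it stays at a sink forever, and near \<open>b\<close> it has either been with \<open>b\<close> forever
  or arrived by \<open>u\<close> (at time \<open>c\<close>), and either stays with \<open>b\<close> or leaves by \<open>v\<close> (at time \<open>d\<close>). The equations
  \<open>p = translate (-c) b\<close> and \<open>p = translate (-d) b\<close> record the phase, which makes \<open>d - c\<close> a gap.\<close>

definition regular :: "(int \<Rightarrow> int) \<Rightarrow> int \<Rightarrow> (int \<Rightarrow> int) \<Rightarrow> bool" where
  "regular y j p \<longleftrightarrow> p \<in> P \<and> (\<forall>i. j \<le> i \<and> i < j + q \<longrightarrow> y i = p i) \<and>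
     (p \<in> S \<longrightarrow> (\<forall>i<j + q. y i = p i)) \<and>
     (p \<in> E \<longrightarrow> (\<forall>i\<ge>j. y i = p i)) \<and>
     (p \<in> orbit b \<longrightarrow>
       ((\<forall>i<j + q. y i = p i) \<or> (\<exists>c\<le>j. p = translate (-c) b \<and> (\<forall>i<j + q. y i = u (i - c)))) \<and>
       ((\<forall>i\<ge>j. y i = p i) \<or> (\<exists>d\<ge>j + q. p = translate (-d) b \<and> (\<forall>i\<ge>j. y i = v (i - d)))))"

definition irregular :: "(int \<Rightarrow> int) \<Rightarrow> int set" where
  "irregular y = {j. \<nexists>p. regular y j p}"

lemma regular_translate:
  assumes "regular y j p" shows "regular (translate k y) (j - k) (translate k p)"
proof -
  have c: "\<exists>c'\<le>j - k. translate k p = translate (-c') b \<and> (\<forall>i<j - k + q. y (i + k) = u (i - c'))"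
    if "c \<le> j" "p = translate (-c) b" "\<forall>i<j + q. y i = u (i - c)" for c
    using that by (intro exI[of _ "c - k"]) (auto simp: algebra_simps)
  have d: "\<exists>d'\<ge>j - k + q. translate k p = translate (-d') b \<and> (\<forall>i\<ge>j - k. y (i + k) = v (i - d'))"
    if "d \<ge> j + q" "p = translate (-d) b" "\<forall>i\<ge>j. y i = v (i - d)" for d
    using that by (intro exI[of _ "d - k"]) (auto simp: algebra_simps)
  have "(\<forall>i<j - k + q. y (i + k) = p (i + k)) \<or>
      (\<exists>c\<le>j - k. translate k p = translate (-c) b \<and> (\<forall>i<j - k + q. y (i + k) = u (i - c)))"
    if b: "p \<in> orbit b"
  proof -
    have "(\<forall>i<j + q. y i = p i) \<or> (\<exists>c\<le>j. p = translate (-c) b \<and> (\<forall>i<j + q. y i = u (i - c)))"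
      using assms b by (simp add: regular_def)
    then show ?thesis using c by (elim disjE exE conjE) auto
  qed
  moreover have "(\<forall>i\<ge>j - k. y (i + k) = p (i + k)) \<or>
      (\<exists>d\<ge>j - k + q. translate k p = translate (-d) b \<and> (\<forall>i\<ge>j - k. y (i + k) = v (i - d)))"
    if b: "p \<in> orbit b"
  proof -
    have "(\<forall>i\<ge>j. y i = p i) \<or> (\<exists>d\<ge>j + q. p = translate (-d) b \<and> (\<forall>i\<ge>j. y i = v (i - d)))"
      using assms b by (simp add: regular_def)
    then show ?thesis using d by (elim disjE exE conjE) auto
  qed
  moreover have "translate k p \<in> P" "\<forall>i. j - k \<le> i \<and> i < j - k + q \<longrightarrow> y (i + k) = p (i + k)"
    "p \<in> S \<longrightarrow> (\<forall>i<j - k + q. y (i + k) = p (i + k))" "p \<in> E \<longrightarrow> (\<forall>i\<ge>j - k. y (i + k) = p (i + k))"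
    using assms P_inv by (auto simp: regular_def)
  ultimately show ?thesis
    unfolding regular_def translate_S_iff translate_E_iff translate_orbit_iff translate_apply
    by blast
qed

lemma regular_S: "p \<in> S \<Longrightarrow> \<forall>i<j + q. y i = p i \<Longrightarrow> regular y j p"
  using S_not by (auto simp: regular_def P_def)

lemma regular_E: "p \<in> E \<Longrightarrow> \<forall>i\<ge>j. y i = p i \<Longrightarrow> regular y j p"
  using E_not by (auto simp: regular_def P_def)

lemma regular_P: "y \<in> P \<Longrightarrow> regular y j y"
  by (auto simp: regular_def)

lemma few_irregular_translate:
  assumes "irregular y \<subseteq> A" "finite A" "int (card A) \<le> N"
  shows "finite (irregular (translate k y)) \<and> int (card (irregular (translate k y))) \<le> N"
proof -
  have sub: "irregular (translate k y) \<subseteq> (\<lambda>j. j - k) ` A"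
  proof
    fix j assume "j \<in> irregular (translate k y)"
    then have "j + k \<in> irregular y"
      using regular_translate[of y "j + k" _ k] by (auto simp: irregular_def)
    then show "j \<in> (\<lambda>j. j - k) ` A"
      using assms(1) by (intro image_eqI[of _ _ "j + k"]) auto
  qed
  have "card (irregular (translate k y)) \<le> card A"
    using card_mono[OF _ sub] card_image_le[OF assms(2), of "\<lambda>j. j - k"] assms(2) by fastforce
  then show ?thesis using finite_subset[OF sub] assms by auto
qed

lemma irregular_T: "t \<in> T \<Longrightarrow> irregular t \<subseteq> {-q<..<l}"
proof
  fix j assume t: "t \<in> T" and j: "j \<in> irregular t"
  obtain p p' where "p \<in> S" "\<forall>i<0. t i = p i" "p' \<in> E" "\<forall>i\<ge>l. t i = p' i"
    using T_left[OF t] T_right[OF t] by blast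
  then have "\<not> j + q \<le> 0" "\<not> l \<le> j"
    using j regular_S[of p j t] regular_E[of p' j t] by (auto simp: irregular_def)
  then show "j \<in> {-q<..<l}" by auto
qed

lemma irregular_u: "irregular u \<subseteq> {-l-q<..<0}"
proof
  fix j assume j: "j \<in> irregular u"
  obtain p where "p \<in> S" "\<forall>i< -l. u i = p i" using u_left by blast
  then have "\<not> j + q \<le> - l" using j regular_S[of p j u] by (auto simp: irregular_def)
  moreover have "regular u j b" if "j \<ge> 0"
  proof -
    have "\<exists>c\<le>j. b = translate (-c) b \<and> (\<forall>i<j + q. u i = u (i - c))"
      using that by (intro exI[of _ 0]) auto
    then show ?thesis
      using that u_right b_notin by (auto simp: regular_def P_def)
  qed
  ultimately have "\<not> j + q \<le> - l" "\<not> 0 \<le> j" using j by (auto simp: irregular_def)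
  then show "j \<in> {-l-q<..<0}" by auto
qed

lemma irregular_v: "irregular v \<subseteq> {-q<..<l}"
proof
  fix j assume j: "j \<in> irregular v"
  obtain p where "p \<in> E" "\<forall>i\<ge>l. v i = p i" using v_right by blast
  then have "\<not> l \<le> j" using j regular_E[of p j v] by (auto simp: irregular_def)
  moreover have "regular v j b" if "j + q \<le> 0"
  proof -
    have "\<exists>d\<ge>j + q. b = translate (-d) b \<and> (\<forall>i\<ge>j. v i = v (i - d))"
      using that by (intro exI[of _ 0]) auto
    then show ?thesis
      using that v_left b_notin by (auto simp: regular_def P_def)
  qed
  ultimately have "\<not> l \<le> j" "\<not> j + q \<le> 0" using j by (auto simp: irregular_def)
  then show "j \<in> {-q<..<l}" by auto
qed

lemma irregular_bridge:
  assumes "g \<in> gaps" shows "irregular (bridge g) \<subseteq> {-l-q<..<0} \<union> {int g - q<..<int g + l}"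
proof
  fix j assume j: "j \<in> irregular (bridge g)"
  obtain p where "p \<in> S" "\<forall>i< -l. u i = p i" using u_left by blast
  then have "\<not> j + q \<le> - l"
    using j regular_S[of p j "bridge g"] l_nonneg by (auto simp: irregular_def bridge_left)
  moreover have "\<not> int g + l \<le> j"
  proof
    assume "int g + l \<le> j"
    moreover obtain p where p: "p \<in> E" "\<forall>i\<ge>l. v i = p i" using v_right by blast
    ultimately have "regular (bridge g) j (translate (- int g) p)"
      using l_nonneg by (intro regular_E E_inv) (auto simp: bridge_def)
    then show False using j by (auto simp: irregular_def)
  qed
  moreover have "regular (bridge g) j b" if "0 \<le> j" "j + q \<le> int g"
  proof -
    have "\<exists>c\<le>j. b = translate (-c) b \<and> (\<forall>i<j + q. bridge g i = u (i - c))"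
      using that by (intro exI[of _ 0]) (auto simp: bridge_left)
    moreover have "b = translate (- int g) b"
      using b_gap[OF assms] by (auto simp: fun_eq_iff)
    then have "\<exists>d\<ge>j + q. b = translate (-d) b \<and> (\<forall>i\<ge>j. bridge g i = v (i - d))"
      using that bridge_right[OF assms] by (intro exI[of _ "int g"]) auto
    ultimately show ?thesis
      using that b_notin by (auto simp: regular_def P_def bridge_mid)
  qed
  ultimately have "\<not> j + q \<le> - l" "\<not> int g + l \<le> j" "\<not> (0 \<le> j \<and> j + q \<le> int g)"
    using j by (auto simp: irregular_def)
  then show "j \<in> {-l-q<..<0} \<union> {int g - q<..<int g + l}" by auto
qed

text \<open>A point is irregular only at positions whose window of length \<open>q\<close> meets a transition; it makes at
  most two transitions, of length at most \<open>l\<close> each.\<close>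

lemma few_irregular:
  assumes "K \<subseteq> gaps" "y \<in> bridged K"
  shows "finite (irregular y) \<and> int (card (irregular y)) \<le> 2 * (l + q)"
  using assms(2)
proof (cases rule: bridged_cases)
  case 1
  then have "irregular y = {}" using regular_P by (auto simp: irregular_def)
  then show ?thesis using q_pos l_nonneg by simp
next
  case (2 t k)
  have "irregular t \<subseteq> {-q<..<l} \<or> irregular t \<subseteq> {-l-q<..<0}"
    using 2(1) irregular_u irregular_v irregular_T by blast
  then show ?thesis
    unfolding 2(2) using q_pos l_nonneg by (elim disjE) (erule few_irregular_translate, simp_all)+
next
  case (3 g k)
  have "card ({-l-q<..<0} \<union> {int g - q<..<int g + l}) \<le> card {-l-q<..<0} + card {int g - q<..<int g + l}"
    by (rule card_Un_le)
  then have "int (card ({-l-q<..<0} \<union> {int g - q<..<int g + l})) \<le> 2 * (l + q)"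
    using q_pos l_nonneg by simp
  then show ?thesis
    unfolding 3(2) using irregular_bridge 3(1) assms(1)
    by (intro few_irregular_translate) auto
qed

text \<open>Two points have at most \<open>4 * (l + q)\<close> irregular positions together; the extra \<open>q\<close> leaves room for a
  full period after the position that remains.\<close>

definition memory :: int where "memory = 4 * (l + q) + q"

text \<open>Pigeonhole gives a position that is regular for both points; the two periodic points agree on a full
  common period there, so they coincide.\<close>

lemma common_regular:
  assumes "y \<in> bridged gaps" "y' \<in> bridged gaps"
    and eq: "\<And>i'. i \<le> i' \<Longrightarrow> i' < i + memory \<Longrightarrow> y i' = y' i'"
  obtains j p where "i \<le> j" "j + q \<le> i + memory" "regular y j p" "regular y' j p"
proof -
  let ?J = "{i..i + memory - q}"
  have irr: "finite (irregular y)" "finite (irregular y')"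
    "int (card (irregular y)) \<le> 2 * (l + q)" "int (card (irregular y')) \<le> 2 * (l + q)"
    using few_irregular assms(1,2) by auto
  have "card (irregular y \<union> irregular y') \<le> card (irregular y) + card (irregular y')"
    by (rule card_Un_le)
  then have "card (irregular y \<union> irregular y') < card ?J"
    using irr q_pos l_nonneg by (simp add: memory_def)
  then have "\<not> ?J \<subseteq> irregular y \<union> irregular y'"
    using card_mono[of "irregular y \<union> irregular y'" ?J] irr by auto
  then obtain j where j': "j \<in> ?J" "j \<notin> irregular y" "j \<notin> irregular y'" by blast
  then have j: "i \<le> j" "j + q \<le> i + memory" by auto
  obtain p p' where p: "regular y j p" "regular y' j p'"
    using j' by (auto simp: irregular_def)
  have "p = p'"
    by (rule P_eqI[where j = j]) (use j p eq in \<open>auto simp: regular_def\<close>)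
  then show ?thesis using that j p by blast
qed

text \<open>At a common regular position with periodic point \<open>p\<close>, the spliced point is \<open>y'\<close> if \<open>p\<close> is a source,
  since both points have the same past, and \<open>y\<close> if \<open>p\<close> is a sink, since both have the same future. Along
  the orbit of \<open>b\<close> the past of \<open>y\<close> and the future of \<open>y'\<close> combine to a point of that orbit, a translate
  of \<open>u\<close> or \<open>v\<close>, or a bridge.\<close>

lemma splice_in_bridged:
  assumes "y \<in> bridged gaps" "y' \<in> bridged gaps"
    and eq: "\<And>i'. i \<le> i' \<Longrightarrow> i' < i + memory \<Longrightarrow> y i' = y' i'"
  shows "(\<lambda>k. if k < i + memory then y k else y' k) \<in> bridged gaps"
proof -
  define z where "z = (\<lambda>k. if k < i + memory then y k else y' k)"
  obtain j p where j: "i \<le> j" "j + q \<le> i + memory" and p: "regular y j p" "regular y' j p"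
    using common_regular[OF assms] by blast
  have z1: "z k = (if k < j + q then y k else y' k)" and z2: "z k = (if k < j then y k else y' k)" for k
    using j eq[of k] q_pos by (auto simp: z_def)
  consider "p \<in> S" | "p \<in> E" | "p \<in> orbit b" using p(1) by (auto simp: regular_def P_def)
  then have "z \<in> bridged gaps"
  proof cases
    case 1
    then have "z = y'" using p by (intro ext) (simp add: regular_def z1)
    then show ?thesis using assms by simp
  next
    case 2
    then have "z = y" using p by (intro ext) (simp add: regular_def z2)
    then show ?thesis using assms by simp
  next
    case 3
    have left: "(\<forall>k<j + q. y k = p k) \<or>
        (\<exists>c\<le>j. p = translate (-c) b \<and> (\<forall>k<j + q. y k = u (k - c)))"
      using p(1) 3 by (simp add: regular_def)
    have right: "(\<forall>k\<ge>j. y' k = p k) \<or>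
        (\<exists>d\<ge>j + q. p = translate (-d) b \<and> (\<forall>k\<ge>j. y' k = v (k - d)))"
      using p(2) 3 by (simp add: regular_def)
    show ?thesis
      using left
    proof (elim disjE exE conjE)
      assume y: "\<forall>k<j + q. y k = p k"
      show ?thesis
        using right
      proof (elim disjE exE conjE)
        assume "\<forall>k\<ge>j. y' k = p k"
        then have "z = p" using y q_pos by (intro ext) (simp add: z1)
        then show ?thesis using 3 P_subset_bridged by (auto simp: P_def)
      next
        fix d assume d: "d \<ge> j + q" "p = translate (-d) b" "\<forall>k\<ge>j. y' k = v (k - d)"
        have "z = translate (-d) v"
        proof
          fix k show "z k = translate (-d) v k"
            using y d v_left[of "k - d"] q_pos by (auto simp: z1)
        qed
        then show ?thesis using orbit_subset_bridged(1)[of v "-d"] by simp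
      qed
    next
      fix c assume c: "c \<le> j" "p = translate (-c) b" "\<forall>k<j + q. y k = u (k - c)"
      show ?thesis
        using right
      proof (elim disjE exE conjE)
        assume y': "\<forall>k\<ge>j. y' k = p k"
        have "z = translate (-c) u"
        proof
          fix k show "z k = translate (-c) u k"
            using y' c u_right[of "k - c"] q_pos by (auto simp: z1)
        qed
        then show ?thesis using orbit_subset_bridged(1)[of u "-c"] by simp
      next
        fix d assume d: "d \<ge> j + q" "p = translate (-d) b" "\<forall>k\<ge>j. y' k = v (k - d)"
        define g where "g = nat (d - c)"
        have g: "int g = d - c" using c d q_pos by (simp add: g_def)
        have bc: "b (k - c) = b (k - d)" for k
          using c(2) d(2) by (metis translate_apply diff_conv_add_uminus)
        have "b (k + int g) = b k" for k
          using bc[of "k + d"] unfolding g by (simp add: algebra_simps)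
        then have gaps: "g \<in> gaps" by (auto simp: gaps_def)
        have "z = translate (-c) (bridge g)"
        proof
          fix k
          show "z k = translate (-c) (bridge g) k"
          proof (cases "k < j + q")
            case True
            then show ?thesis using c d g by (simp add: z1 bridge_left)
          next
            case False
            then show ?thesis
              using c d g q_pos bridge_right[OF gaps, of "k - c"] by (simp add: z1)
          qed
        qed
        then show ?thesis using orbit_subset_bridged(2)[OF gaps, of "-c"] by simp
      qed
    qed
  qed
  then show ?thesis by (simp add: z_def)
qed

text \<open>The window reaches so far that \<open>y\<close> and \<open>bridge g\<close> have a common regular position on each side of it,
  the left one at a source and the right one at a sink. These fix the past and the future of \<open>y\<close>.\<close>

lemma bridge_isolated:
  assumes g: "g \<in> gaps" and y: "y \<in> bridged gaps"
    and eq: "\<And>i. - l - memory \<le> i \<Longrightarrow> i < int g + l + memory \<Longrightarrow> y i = bridge g i"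
  shows "y = bridge g"
proof -
  have ord: "memory > 0" using q_pos l_nonneg by (simp add: memory_def)
  have bg: "bridge g \<in> bridged gaps" using bridge_in_bridged g .
  obtain j p where j: "- l - memory \<le> j" "j + q \<le> - l" and p: "regular y j p" "regular (bridge g) j p"
    by (rule common_regular[OF y bg, of "- l - memory"]) (use eq ord l_nonneg in auto)
  obtain p0 where p0: "p0 \<in> S" "\<forall>i< -l. u i = p0 i" using u_left by blast
  have "p = p0"
    by (rule P_eqI[where j = j])
      (use p p0 j l_nonneg in \<open>auto simp: regular_def P_def bridge_left\<close>)
  then have left: "y i = bridge g i" if "i < j + q" for i
    using p p0 that by (auto simp: regular_def)
  obtain j' p' where j': "int g + l \<le> j'" "j' + q \<le> int g + l + memory"
    and p': "regular y j' p'" "regular (bridge g) j' p'"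
    by (rule common_regular[OF y bg, of "int g + l"]) (use eq ord l_nonneg in auto)
  obtain p1 where p1: "p1 \<in> E" "\<forall>i\<ge>l. v i = p1 i" using v_right by blast
  have p1': "translate (- int g) p1 \<in> E" using p1 E_inv by blast
  have "p' = translate (- int g) p1"
  proof (rule P_eqI[where j = j'])
    show "p' i = translate (- int g) p1 i" if "j' \<le> i" "i < j' + q" for i
    proof -
      have "p' i = bridge g i" using p'(2) that by (simp add: regular_def)
      then show ?thesis using p1 that j' l_nonneg bridge_right[OF g, of i] by simp
    qed
  qed (use p' p1' in \<open>auto simp: regular_def P_def\<close>)
  then have right: "y i = bridge g i" if "i \<ge> j'" for i
    using p' p1' that by (auto simp: regular_def)
  show ?thesis
  proof
    fix i
    consider "i < j + q" | "i \<ge> j'" | "- l - memory \<le> i" "i < int g + l + memory"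
      using j j' q_pos by linarith
    then show "y i = bridge g i" using left right eq by cases auto
  qed
qed

end

lemma finite_separation:
  assumes "finite F" "y \<notin> F"
  shows "\<exists>N\<ge>0::int. \<forall>z\<in>F. \<exists>i. \<bar>i\<bar> \<le> N \<and> z i \<noteq> y i"
  using assms
proof (induction F rule: finite_induct)
  case empty
  show ?case by (intro exI[of _ 0]) simp
next
  case (insert z F)
  then obtain N where N: "N \<ge> 0" "\<forall>z\<in>F. \<exists>i. \<bar>i\<bar> \<le> N \<and> z i \<noteq> y i" by auto
  from insert obtain j where "z j \<noteq> y j" by (metis ext insertI1)
  then have "\<forall>z\<in>insert z F. \<exists>i. \<bar>i\<bar> \<le> max N \<bar>j\<bar> \<and> z i \<noteq> y i"
    using N(2) by (auto simp: le_max_iff_disj)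
  then show ?case using N(1) by (intro exI[of _ "max N \<bar>j\<bar>"]) auto
qed

text \<open>The tail forces \<open>p\<close> to have the period \<open>e\<close>. Moving to the left in steps of \<open>e\<close> from any \<open>i < M + e\<close>
  leads into the tail without changing the value of \<open>w\<close> or of \<open>p\<close>.\<close>

lemma left_tail_propagates:
  fixes w p :: "int \<Rightarrow> 'a"
  assumes per: "\<And>i. p (i + q) = p i" and q: "q > 0" and tail: "\<And>i. i < N \<Longrightarrow> w i = p i"
    and e: "e > 0" and rep: "\<And>i. i < M \<Longrightarrow> w i = w (i + e)" and i: "i < M + e"
  shows "w i = p i"
proof -
  have pe: "p (i + e) = p i" for i
  proof -
    define k where "k = \<bar>i\<bar> + \<bar>e\<bar> + \<bar>N\<bar> + \<bar>M\<bar> + 1"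
    have "k * q \<ge> k" using q by (simp add: k_def)
    then have j: "i + (- k) * q < N" "i + (- k) * q < M" "i + (- k) * q + e < N"
      unfolding k_def by linarith+
    have "p i = p (i + (- k) * q)" by (rule periodic_mult[symmetric]) (rule per)
    also have "\<dots> = p (i + (- k) * q + e)"
      using tail[OF j(1)] rep[OF j(2)] tail[OF j(3)] by simp
    also have "\<dots> = p (i + e + (- k) * q)" by (simp add: algebra_simps)
    also have "\<dots> = p (i + e)" by (rule periodic_mult) (rule per)
    finally show ?thesis by simp
  qed
  have iter: "w (i - int m * e) = w i" for m
  proof (induction m)
    case (Suc m)
    have "int m * e \<ge> 0" using e by simp
    then have "i - int (Suc m) * e < M" using i by (simp add: algebra_simps)
    from rep[OF this] Suc show ?case by (simp add: algebra_simps)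
  qed simp
  define m where "m = nat (\<bar>i\<bar> + \<bar>N\<bar> + 1)"
  have "int m * e \<ge> int m" using e mult_left_mono[of 1 e "int m"] by simp
  then have "i - int m * e < N" unfolding m_def by linarith
  then have "w i = p (i + (- int m) * e)" using iter[of m] tail by simp
  also have "\<dots> = p i" by (rule periodic_mult) (rule pe)
  finally show ?thesis .
qed

context skeleton
begin

abbreviation transitions :: "(int \<Rightarrow> int) set" where "transitions \<equiv> insert u (insert v T)"

lemma b_in_P: "b \<in> P" by (simp add: P_def)

lemma transition_tails:
  assumes "t \<in> transitions"
  shows "\<exists>p\<in>P. \<forall>i< - l. t i = p i" "\<exists>p\<in>P. \<forall>i\<ge>l. t i = p i"
proof -
  have "\<exists>p\<in>P. \<forall>i< - l. u i = p i" "\<exists>p\<in>P. \<forall>i\<ge>l. v i = p i"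
    using u_left v_right by (auto simp: P_def)
  moreover have "\<forall>i< - l. v i = b i" "\<forall>i\<ge>l. u i = b i"
    using v_left u_right l_nonneg by auto
  moreover have "\<exists>p\<in>P. \<forall>i< - l. t i = p i" "\<exists>p\<in>P. \<forall>i\<ge>l. t i = p i" if "t \<in> T"
    using T_left[OF that] T_right[OF that] l_nonneg unfolding P_def by fastforce+
  ultimately show "\<exists>p\<in>P. \<forall>i< - l. t i = p i" "\<exists>p\<in>P. \<forall>i\<ge>l. t i = p i"
    using assms b_in_P by blast+
qed

section \<open>Bridged subshifts are compact\<close>

lemma transition_periodic_away:
  assumes t: "t \<in> transitions" and N: "N \<ge> 0" "\<bar>c\<bar> > N + l"
  shows "\<exists>p\<in>P. \<forall>i. \<bar>i\<bar> \<le> N \<longrightarrow> translate c t i = p i"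
proof -
  obtain p p' where p: "p \<in> P" "\<forall>i< - l. t i = p i" "p' \<in> P" "\<forall>i\<ge>l. t i = p' i"
    using transition_tails[OF t] by blast
  consider "c < 0" | "c > 0" using N l_nonneg by linarith
  then show ?thesis
  proof cases
    case 1
    then have "\<forall>i. \<bar>i\<bar> \<le> N \<longrightarrow> translate c t i = translate c p i" using p(2) N by auto
    then show ?thesis using P_inv p(1) by blast
  next
    case 2
    then have "\<forall>i. \<bar>i\<bar> \<le> N \<longrightarrow> translate c t i = translate c p' i" using p(4) N by auto
    then show ?thesis using P_inv p(3) by blast
  qed
qed

lemma bridge_periodic_away:
  assumes g: "g \<in> gaps" and N: "N \<ge> 0" "\<bar>c\<bar> > N + l" "\<bar>c - int g\<bar> > N + l"
  shows "\<exists>p\<in>P. \<forall>i. \<bar>i\<bar> \<le> N \<longrightarrow> translate c (bridge g) i = p i"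
proof -
  consider "c < 0" | "0 < c" "c < int g" | "c > int g" using N l_nonneg by linarith
  then show ?thesis
  proof cases
    case 1
    then have "\<forall>i. \<bar>i\<bar> \<le> N \<longrightarrow> translate c (bridge g) i = translate c u i"
      using N l_nonneg by (auto simp: bridge_left)
    then show ?thesis using transition_periodic_away[of u N c] N by auto
  next
    case 2
    then have "\<forall>i. \<bar>i\<bar> \<le> N \<longrightarrow> translate c (bridge g) i = translate c b i"
      using N l_nonneg by (auto intro!: bridge_mid)
    then show ?thesis using P_inv b_in_P by blast
  next
    case 3
    then have "\<forall>i. \<bar>i\<bar> \<le> N \<longrightarrow> translate c (bridge g) i = translate (c - int g) v i"
      using N l_nonneg by (auto simp: bridge_right[OF g] algebra_simps)
    then show ?thesis using transition_periodic_away[of v N "c - int g"] N by auto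
  qed
qed

text \<open>If \<open>y\<close> is outside, a finite window separates it from the finite set \<open>P\<close>. An approximation of \<open>y\<close> on a
  larger window must then make a transition near \<open>0\<close>. So it is one of finitely many translates of
  transitions and short bridges, or a bridge so long that it looks like a translate of \<open>u\<close> or \<open>v\<close>, one of
  finitely many again; all of these are separated from \<open>y\<close> by a finite window.\<close>

lemma bridged_closed:
  assumes K: "K \<subseteq> gaps" and y: "\<And>N. \<exists>z\<in>bridged K. \<forall>i. \<bar>i\<bar> \<le> N \<longrightarrow> z i = y i"
  shows "y \<in> bridged K"
proof (rule ccontr)
  assume out: "y \<notin> bridged K"
  then have "y \<notin> P" using P_subset_bridged by blast
  \<comment> \<open>\<open>N0\<close> separates \<open>y\<close> from \<open>P\<close>, \<open>N1\<close> from the transitions near \<open>0\<close>, and \<open>N2\<close> from the short bridges near \<open>0\<close>.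
    Bridges with \<open>g > G\<close> are so long that at most one of their transitions is visible.\<close>
  then obtain N0 where N0: "N0 \<ge> 0" "\<forall>z\<in>P. \<exists>i. \<bar>i\<bar> \<le> N0 \<and> z i \<noteq> y i"
    using finite_separation[OF finite_P] by blast
  define M where "M = N0 + l"
  define F where "F = (\<lambda>(c, t). translate c t) ` ({-M..M} \<times> transitions)"
  have "finite F" by (simp add: F_def finite_T)
  moreover have "y \<notin> F" using out orbit_subset_bridged(1) by (auto simp: F_def)
  ultimately obtain N1 where N1: "N1 \<ge> 0" "\<forall>z\<in>F. \<exists>i. \<bar>i\<bar> \<le> N1 \<and> z i \<noteq> y i"
    using finite_separation by blast
  define G where "G = N1 + M"
  define F' where
    "F' = (\<lambda>(c, g). translate c (bridge g)) ` ({-(G + M)..G + M} \<times> {g\<in>K. int g \<le> G})"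
  have "{g\<in>K. int g \<le> G} \<subseteq> {..nat G}" by auto
  then have "finite F'" unfolding F'_def by (auto intro: finite_subset)
  moreover have "y \<notin> F'" using out orbit_subset_bridged(2) by (auto simp: F'_def)
  ultimately obtain N2 where N2: "N2 \<ge> 0" "\<forall>z\<in>F'. \<exists>i. \<bar>i\<bar> \<le> N2 \<and> z i \<noteq> y i"
    using finite_separation by blast
  define N where "N = max N0 (max N1 N2)"
  obtain z where z: "z \<in> bridged K" "\<And>i. \<bar>i\<bar> \<le> N \<Longrightarrow> z i = y i" using y by metis
  have noP: False if "p \<in> P" "\<forall>i. \<bar>i\<bar> \<le> N0 \<longrightarrow> z i = p i" for p
    using that N0 z(2) unfolding N_def by (metis max.coboundedI1)
  have noF: False if "x \<in> F" "\<And>i. \<bar>i\<bar> \<le> N1 \<Longrightarrow> z i = x i" for x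
    using that N1 z(2) unfolding N_def by (metis max.coboundedI1 max.coboundedI2)
  from z(1) show False
  proof (cases rule: bridged_cases)
    case 1
    then show False using noP by blast
  next
    case (2 t c)
    show False
    proof (cases "\<bar>c\<bar> > N0 + l")
      case True
      then show False using transition_periodic_away[OF 2(1) N0(1) True] noP 2(2) by blast
    next
      case False
      then have "z \<in> F" using 2 unfolding F_def M_def by (intro image_eqI[of _ _ "(c, t)"]) auto
      then show False using noF by blast
    qed
  next
    case (3 g c)
    then have g: "g \<in> gaps" using K by blast
    show False
    proof (cases "\<bar>c\<bar> > N0 + l \<and> \<bar>c - int g\<bar> > N0 + l")
      case True
      then show False using bridge_periodic_away[OF g N0(1), of c] noP 3(2) by blast
    next
      case False
      then have "\<bar>c\<bar> \<le> M \<or> \<bar>c - int g\<bar> \<le> M" by (auto simp: M_def)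
      then consider "int g \<le> G" | "int g > G" "\<bar>c\<bar> \<le> M" | "int g > G" "\<bar>c - int g\<bar> \<le> M"
        by linarith
      then show False
      proof cases
        case 1
        then have "z \<in> F'"
          using 3 False l_nonneg N0 unfolding F'_def
          by (intro image_eqI[of _ _ "(c, g)"]) (auto simp: M_def)
        then obtain i where "\<bar>i\<bar> \<le> N2" "z i \<noteq> y i" using N2 by blast
        then show False using z(2)[of i] by (auto simp: N_def)
      next
        case 2
        have "translate c u \<in> F" using 2 unfolding F_def by (intro image_eqI[of _ _ "(c, u)"]) auto
        moreover have "z i = translate c u i" if "\<bar>i\<bar> \<le> N1" for i
          using that 2 3(2) by (auto simp: G_def bridge_left)
        ultimately show False using noF by blast
      next
        case c: 3
        have "translate (c - int g) v \<in> F"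
          using c unfolding F_def by (intro image_eqI[of _ _ "(c - int g, v)"]) auto
        moreover have "z i = translate (c - int g) v i" if "\<bar>i\<bar> \<le> N1" for i
          using that c 3(2) bridge_right[OF g, of "i + c"] by (auto simp: G_def algebra_simps)
        ultimately show False using noF by blast
      qed
    qed
  qed
qed

lemma subshift_bridged:
  assumes "K \<subseteq> gaps" shows "subshift (bridged K)"
proof (rule subshiftI)
  define A where "A = (\<Union>p\<in>P. p ` {0..<q}) \<union> (\<Union>t\<in>transitions. t ` {-l..l})"
  show "finite A" by (simp add: A_def finite_P finite_T)
  have P: "p i \<in> A" if "p \<in> P" for p i
  proof -
    have "p i = p (0 + (i - 0) mod q)"
      by (rule periodic_mod[symmetric]) (rule P_periodic[OF that])
    moreover have "0 + (i - 0) mod q \<in> {0..<q}" using q_pos by simp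
    ultimately show ?thesis using that unfolding A_def by blast
  qed
  have t: "t i \<in> A" if t: "t \<in> transitions" for t i
  proof (cases "- l \<le> i \<and> i \<le> l")
    case True
    then have "t i \<in> t ` {-l..l}" by auto
    then have "t i \<in> (\<Union>t\<in>transitions. t ` {-l..l})" using t by (rule UN_I[rotated])
    then show ?thesis unfolding A_def by (rule UnI2)
  next
    case False
    obtain p p' where "p \<in> P" "\<forall>i< - l. t i = p i" "p' \<in> P" "\<forall>i\<ge>l. t i = p' i"
      using transition_tails[OF t] by blast
    then show ?thesis using False P[of p i] P[of p' i] by (cases "i < - l") auto
  qed
  show "y i \<in> A" if "y \<in> bridged K" for y i
    using that
  proof (cases rule: bridged_cases)
    case 1 then show ?thesis using P by blast
  next
    case (2 s k) then show ?thesis using t by simp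
  next
    case (3 g k)
    then have "y i = u (i + k) \<or> y i = v (i + k - int g)" by (simp add: bridge_def)
    then show ?thesis using t by force
  qed
  show "bridged K \<noteq> {}" using b_in_P P_subset_bridged by blast
qed (use bridged_inv bridged_closed[OF assms] in auto)

section \<open>Bridged subshifts of finite type\<close>

text \<open>By splicing, each word of \<open>z\<close> extends letter by letter to a longer word of a bridged point; closedness
  then puts \<open>z\<close> itself among them.\<close>

lemma bridged_finite_type:
  assumes z: "\<And>i. window (Suc (nat memory)) z i \<in> words (Suc (nat memory)) (bridged gaps)"
  shows "z \<in> bridged gaps"
proof -
  have mem: "int (Suc (nat memory)) = memory + 1"
    using q_pos l_nonneg by (simp add: memory_def)
  have local: "\<exists>y\<in>bridged gaps. \<forall>k. i \<le> k \<and> k < i + memory + 1 \<longrightarrow> y k = z k" for i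
  proof -
    obtain y j where y: "y \<in> bridged gaps" "window (Suc (nat memory)) z i = window (Suc (nat memory)) y j"
      using z[of i] by (auto simp: words_alt)
    have "translate (j - i) y k = z k" if "i \<le> k" "k < i + memory + 1" for k
      using window_eqD[OF y(2), of k] that mem by (simp add: algebra_simps)
    then show ?thesis using bridged_inv[OF y(1)] by blast
  qed
  have "\<exists>y\<in>bridged gaps. \<forall>k. i \<le> k \<and> k < i + memory + 1 + int m \<longrightarrow> y k = z k" for i m
  proof (induction m)
    case 0
    show ?case using local[of i] by simp
  next
    case (Suc m)
    then obtain y where y: "y \<in> bridged gaps"
      "\<And>k. i \<le> k \<Longrightarrow> k < i + memory + 1 + int m \<Longrightarrow> y k = z k" by blast
    define i' where "i' = i + int m + 1"
    obtain y' where y': "y' \<in> bridged gaps"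
      "\<And>k. i' \<le> k \<Longrightarrow> k < i' + memory + 1 \<Longrightarrow> y' k = z k" using local[of i'] by blast
    have "(\<lambda>k. if k < i' + memory then y k else y' k) \<in> bridged gaps"
    proof (rule splice_in_bridged[OF y(1) y'(1)])
      show "y k = y' k" if "i' \<le> k" "k < i' + memory" for k
        using y(2)[of k] y'(2)[of k] that by (simp add: i'_def)
    qed
    moreover have "\<forall>k. i \<le> k \<and> k < i + memory + 1 + int (Suc m) \<longrightarrow>
        (if k < i' + memory then y k else y' k) = z k"
      using y(2) y'(2) q_pos l_nonneg by (auto simp: i'_def memory_def)
    ultimately show ?case by (intro bexI)
  qed
  then have approx: "\<exists>y\<in>bridged gaps. \<forall>k. - N \<le> k \<and> k < - N + memory + 1 + int (nat (2 * N + 1)) \<longrightarrow> y k = z k" for N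
    by blast
  show ?thesis
  proof (rule bridged_closed[OF order_refl])
    fix N
    obtain y where y: "y \<in> bridged gaps"
      "\<forall>k. - N \<le> k \<and> k < - N + memory + 1 + int (nat (2 * N + 1)) \<longrightarrow> y k = z k"
      using approx by blast
    have "0 < memory" using q_pos l_nonneg by (simp add: memory_def)
    have "y k = z k" if "\<bar>k\<bar> \<le> N" for k
    proof -
      have "- N \<le> k" "k < - N + memory + 1 + int (nat (2 * N + 1))"
        using that \<open>0 < memory\<close> by linarith+
      then show ?thesis using y(2) by blast
    qed
    then show "\<exists>y\<in>bridged gaps. \<forall>k. \<bar>k\<bar> \<le> N \<longrightarrow> y k = z k" using y(1) by blast
  qed
qed

lemma nearby_subset:
  assumes "K \<subseteq> gaps" "words (Suc (nat memory)) Z = words (Suc (nat memory)) (bridged K)"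
  shows "Z \<subseteq> bridged gaps"
proof
  fix z assume "z \<in> Z"
  then show "z \<in> bridged gaps"
    using window_in_words[of z Z] assms words_mono[OF bridged_mono[OF assms(1)]]
    by (intro bridged_finite_type) blast
qed

section \<open>Asymptotic behaviour of bridged points\<close>

lemma bridged_tails:
  assumes "K \<subseteq> gaps" "y \<in> bridged K"
  shows "\<exists>p\<in>P. \<forall>\<^sub>F i in at_bot. y i = p i" "\<exists>p\<in>P. \<forall>\<^sub>F i in at_top. y i = p i"
proof -
  have "(\<exists>p\<in>P. \<exists>N. \<forall>i<N. y i = p i) \<and> (\<exists>p\<in>P. \<exists>N. \<forall>i\<ge>N. y i = p i)"
    using assms(2)
  proof (cases rule: bridged_cases)
    case (2 t k)
    obtain p p' where p: "p \<in> P" "\<forall>i< - l. t i = p i" "p' \<in> P" "\<forall>i\<ge>l. t i = p' i"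
      using transition_tails[OF 2(1)] by blast
    have "\<forall>i< - l - k. y i = translate k p i" "\<forall>i\<ge>l - k. y i = translate k p' i"
      using p 2(2) by auto
    then show ?thesis using P_inv p by blast
  next
    case (3 g k)
    obtain p where p: "p \<in> P" "\<forall>i< - l. u i = p i"
      using transition_tails[of u] by blast
    obtain p' where p': "p' \<in> P" "\<forall>i\<ge>l. v i = p' i"
      using transition_tails[of v] by blast
    have "\<forall>i< - l - k. y i = translate k p i" "\<forall>i\<ge>l + int g - k. y i = translate (k - int g) p' i"
      using p p' 3 l_nonneg by (auto simp: bridge_def algebra_simps)
    then show ?thesis using P_inv p p' by blast
  qed blast
  then show "\<exists>p\<in>P. \<forall>\<^sub>F i in at_bot. y i = p i" "\<exists>p\<in>P. \<forall>\<^sub>F i in at_top. y i = p i"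
    unfolding eventually_at_bot_dense eventually_at_top_linorder by blast+
qed

lemma bridged_bi_asymptotic:
  assumes "K \<subseteq> gaps" "y \<in> bridged K"
  shows "bi_asymptotic y (orbit ` P)"
proof -
  have sub: "p \<in> \<Union>(orbit ` P)" if "p \<in> P" for p
    using that orbit_self by blast
  obtain p p' where "p \<in> P" "\<forall>\<^sub>F i in at_bot. y i = p i" "p' \<in> P" "\<forall>\<^sub>F i in at_top. y i = p' i"
    using bridged_tails[OF assms] by blast
  then show ?thesis
    unfolding bi_asymptotic_def using sub[of p] sub[of p'] by blast
qed

lemma P_periodic_orbits: "A \<in> orbit ` P \<Longrightarrow> periodic_orbit A"
proof -
  assume "A \<in> orbit ` P"
  then obtain p where p: "p \<in> P" "A = orbit p" by blast
  have "(shift ^^ nat q) p = p"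
    using P_periodic[OF p(1)] q_pos by (auto simp: shift_funpow fun_eq_iff)
  then show "periodic_orbit A"
    unfolding periodic_orbit_def using p(2) q_pos by (intro exI[of _ p]) (auto intro!: exI[of _ "nat q"])
qed

lemma countable_bridged: "countable (bridged K)"
proof -
  have orbit: "countable (orbit x)" for x by (simp add: orbit_eq_range)
  show ?thesis
    unfolding bridged_def using finite_P finite_T orbit
    by (intro countable_Un countable_UN) (auto intro: countable_finite)
qed

section \<open>Complexity near bridged subshifts\<close>

lemma bridge_window:
  assumes "g \<in> gaps"
  shows "i + int n \<le> int g \<Longrightarrow> window n (bridge g) i = window n u i"
    and "i \<ge> 0 \<Longrightarrow> window n (bridge g) i = window n v (i - int g)"
  by (auto intro!: window_eqI simp: bridge_left bridge_right[OF assms] algebra_simps)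

text \<open>A constant for the linear part of the complexity, contributed by the periodic points and the
  transitions.\<close>

definition growth :: nat where "growth = card P + card transitions * (2 * nat l + 1)"

text \<open>A word of a bridge that is not a word of \<open>u\<close> or of the delayed \<open>v\<close> starts before \<open>0\<close> and ends after \<open>g\<close>.
  This requires \<open>g < n\<close> and leaves fewer than \<open>n\<close> starting positions.\<close>

lemma complexity_bridged_le:
  assumes "K \<subseteq> gaps"
  shows "complexity (bridged K) n \<le> growth * Suc n + card {g\<in>K. g < n} * n"
proof -
  let ?W0 = "(\<lambda>p. window n p 0) ` P"
  let ?W1 = "(\<lambda>(t, i). window n t i) ` (transitions \<times> {- int n - l..<l})"
  let ?W2 = "(\<lambda>(g, i). window n (bridge g) i) ` ({g\<in>K. g < n} \<times> {- int n..<0})"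
  have P: "window n p i \<in> ?W0" if "p \<in> P" for p i
    using P_inv[OF that, of i] by (intro image_eqI[of _ _ "translate i p"]) simp_all
  have t: "window n t i \<in> ?W0 \<union> ?W1" if t: "t \<in> transitions" for t i
  proof -
    obtain p p' where p: "p \<in> P" "\<forall>i< - l. t i = p i" "p' \<in> P" "\<forall>i\<ge>l. t i = p' i"
      using transition_tails[OF t] by blast
    consider "i < - int n - l" | "i \<ge> l" | "i \<in> {- int n - l..<l}" by fastforce
    then show ?thesis
    proof cases
      case 1
      then have "window n t i = window n p i" using p(2) by (intro window_eqI) auto
      then show ?thesis using P[OF p(1)] by simp
    next
      case 2
      then have "window n t i = window n p' i" using p(4) by (intro window_eqI) auto
      then show ?thesis using P[OF p(3)] by simp
    next
      case 3
      then show ?thesis using t by blast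
    qed
  qed
  have "words n (bridged K) \<subseteq> ?W0 \<union> ?W1 \<union> ?W2"
  proof
    fix w assume "w \<in> words n (bridged K)"
    then obtain y i where y: "y \<in> bridged K" "w = window n y i" by (auto simp: words_alt)
    from y(1) show "w \<in> ?W0 \<union> ?W1 \<union> ?W2"
    proof (cases rule: bridged_cases)
      case 1
      then show ?thesis using P y by blast
    next
      case (2 s k)
      then show ?thesis using t[of s "i + k"] y by auto
    next
      case (3 g k)
      then have g: "g \<in> gaps" using assms by blast
      have w: "w = window n (bridge g) (i + k)" using 3 y by simp
      consider "i + k + int n \<le> int g" | "i + k \<ge> 0" | "i + k < 0" "i + k + int n > int g" by linarith
      then show ?thesis
      proof cases
        case 1
        then show ?thesis using w bridge_window(1)[OF g] t[of u] by simp
      next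
        case 2
        then show ?thesis using w bridge_window(2)[OF g] t[of v] by simp
      next
        case c: 3
        then have "(g, i + k) \<in> {g\<in>K. g < n} \<times> {- int n..<0}" using 3(1) by auto
        then show ?thesis using w by (auto intro: image_eqI)
      qed
    qed
  qed
  moreover have fin: "finite ?W0" "finite ?W1" "finite ?W2"
    using finite_P finite_T by auto
  ultimately have "complexity (bridged K) n \<le> card (?W0 \<union> ?W1 \<union> ?W2)"
    unfolding complexity_def by (intro card_mono) auto
  also have "\<dots> \<le> card ?W0 + card ?W1 + card ?W2"
    by (meson add_mono card_Un_le le_trans order_refl)
  also have "\<dots> \<le> card P + card transitions * (n + 2 * nat l) + card {g\<in>K. g < n} * n"
  proof (intro add_mono)
    show "card ?W0 \<le> card P" by (rule card_image_le[OF finite_P])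
    have "card ?W1 \<le> card (transitions \<times> {- int n - l..<l})"
      using finite_T by (intro card_image_le) simp
    also have "\<dots> = card transitions * (n + 2 * nat l)"
    proof -
      have "nat (2 * l + int n) = n + 2 * nat l" using l_nonneg by linarith
      then show ?thesis by (simp add: card_cartesian_product algebra_simps)
    qed
    finally show "card ?W1 \<le> card transitions * (n + 2 * nat l)" .
    have "card ?W2 \<le> card ({g\<in>K. g < n} \<times> {- int n..<0})"
      by (intro card_image_le) simp
    also have "\<dots> = card {g\<in>K. g < n} * n" by (simp add: card_cartesian_product)
    finally show "card ?W2 \<le> card {g\<in>K. g < n} * n" .
  qed
  also have "card P + card transitions * (n + 2 * nat l) \<le> growth * Suc n"
    by (simp add: growth_def algebra_simps)
  finally show ?thesis by simp
qed

lemma complexity_mono: "X \<subseteq> Y \<Longrightarrow> subshift Y \<Longrightarrow> complexity X n \<le> complexity Y n"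
  unfolding complexity_def using finite_words words_mono by (intro card_mono) auto

text \<open>If the two bridges agree up to a translation by \<open>e > 0\<close> (the case \<open>e < 0\<close> is symmetric), then \<open>u\<close> repeats itself with step \<open>e\<close>, and its
  source tail propagates to a full period of \<open>b\<close>. If \<open>e = 0\<close> and \<open>g < g'\<close>, then \<open>v\<close> repeats itself with step
  \<open>g' - g\<close>, and its sink tail propagates backwards to a full period of \<open>b\<close>. Both contradict that \<open>b\<close> is
  neither a source nor a sink. The gaps must be at least \<open>q\<close> to leave room for that period.\<close>

lemma bridges_distinct:
  assumes g: "g \<in> gaps" "int g \<ge> q" and g': "g' \<in> gaps" "int g' \<ge> q"
    and eq: "bridge g = translate e (bridge g')"
  shows "e = 0 \<and> g = g'"
proof -
  obtain p where p: "p \<in> S" "\<forall>i< - l. u i = p i" using u_left by blast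
  have no_shift: False if "int g1 \<ge> q" "int g2 \<ge> q" "e > 0"
    "bridge g1 = translate e (bridge g2)" for g1 g2 e
  proof -
    have "u i = u (i + e)" if "i < min (int g1) (int g2 - e)" for i
      using fun_cong[OF \<open>bridge g1 = _\<close>, of i] that by (simp add: bridge_left)
    note rep = this
    have uS: "u i = p i" if "i < min (int g1) (int g2 - e) + e" for i
    proof (rule left_tail_propagates[where w = u and p = p and q = q and N = "- l" and M = "min (int g1) (int g2 - e)"])
      show "p (i + q) = p i" for i using periodic p(1) by blast
      show "u i = p i" if "i < - l" for i using that p(2) by blast
    qed (use that rep \<open>e > 0\<close> q_pos in auto)
    then have "b = p"
    proof (intro P_eqI[where j = 0])
      show "b i = p i" if "0 \<le> i" "i < 0 + q" for i
        using uS[of i] that u_right[of i] \<open>int g1 \<ge> q\<close> \<open>int g2 \<ge> q\<close> \<open>e > 0\<close> by simp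
    qed (use p in \<open>auto simp: P_def\<close>)
    then show False using p(1) b_notin by blast
  qed
  have eq': "bridge g' = translate (- e) (bridge g)" using eq by simp
  have "\<not> e > 0" "\<not> - e > 0"
    using no_shift[OF g(2) g'(2) _ eq] no_shift[OF g'(2) g(2) _ eq'] by blast+
  then have e: "e = 0" by linarith
  obtain p1 where p1: "p1 \<in> E" "\<forall>i\<ge>l. v i = p1 i" using v_right by blast
  have no_diff: False if "g1 \<in> gaps" "g2 \<in> gaps" "int g2 \<ge> q" "g1 < g2" "bridge g1 = bridge g2" for g1 g2
  proof -
    \<comment> \<open>Reversing time turns the sink tail of \<open>v\<close> into a left tail.\<close>
    have rep: "v (- i) = v (- (i + (int g2 - int g1)))" if "i < int g1 + 1" for i
      using fun_cong[OF \<open>bridge g1 = _\<close>, of "int g1 - i"] that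
        bridge_right[OF \<open>g1 \<in> gaps\<close>, of "int g1 - i"] bridge_right[OF \<open>g2 \<in> gaps\<close>, of "int g1 - i"]
      by (simp add: algebra_simps)
    have "v (- i) = p1 (- i)" if "i < int g1 + 1 + (int g2 - int g1)" for i
    proof (rule left_tail_propagates[where w = "\<lambda>i. v (- i)" and p = "\<lambda>i. p1 (- i)" and q = q and N = "1 - l"
          and M = "int g1 + 1" and e = "int g2 - int g1"])
      show "p1 (- (i + q)) = p1 (- i)" for i
        using periodic[of p1 "- i - q"] p1(1) by (simp add: algebra_simps)
    qed (use rep p1(2) \<open>g1 < g2\<close> q_pos that in auto)
    note mirrored = this
    have "b = p1"
    proof (intro P_eqI[where j = "- q"])
      show "b i = p1 i" if "- q \<le> i" "i < - q + q" for i
        using mirrored[of "- i"] that v_left[of i] \<open>int g2 \<ge> q\<close> by simp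
    qed (use p1 in \<open>auto simp: P_def\<close>)
    then show False using p1(1) b_notin by blast
  qed
  have "bridge g = bridge g'" using eq e by simp
  then have "g = g'"
    using no_diff[OF g(1) g'(1) g'(2)] no_diff[OF g'(1) g(1) g(2)] by (metis linorder_neqE_nat)
  then show ?thesis using e by simp
qed

text \<open>A window that contains the part of \<open>bridge g\<close> on \<open>[- l - memory, g + l + memory)\<close> determines both \<open>g\<close> and its
  own position, so different such windows are different words.\<close>

lemma complexity_ge:
  assumes Z: "subshift Z" and K: "finite K" "K \<subseteq> gaps" "\<And>g. g \<in> K \<Longrightarrow> int g \<ge> q \<and> g \<le> G"
    and sub: "\<And>g. g \<in> K \<Longrightarrow> bridge g \<in> Z"
  shows "real (card K) * (real n - real_of_int (int G + 2 * (l + memory))) \<le> real (complexity Z n)"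
proof -
  let ?L = "l + memory"
  let ?I = "{int G + ?L - int n..- ?L}"
  let ?f = "\<lambda>(g, i). window n (bridge g) i"
  have "inj_on ?f (K \<times> ?I)"
  proof (rule inj_onI, clarsimp)
    fix g i g' i'
    assume g: "g \<in> K" "g' \<in> K" and i: "int G + ?L - int n \<le> i" "i \<le> - l - memory"
      and eq: "window n (bridge g) i = window n (bridge g') i'"
    have "translate (i' - i) (bridge g') = bridge g"
    proof (rule bridge_isolated)
      show "g \<in> gaps" using g K by blast
      show "translate (i' - i) (bridge g') \<in> bridged gaps"
        using orbit_subset_bridged(2) g K by blast
      show "translate (i' - i) (bridge g') k = bridge g k"
        if "- l - memory \<le> k" "k < int g + l + memory" for k
        using window_eqD[OF eq, of k] that i K(3)[OF g(1)] by (simp add: algebra_simps)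
    qed
    then show "g = g' \<and> i = i'"
      using bridges_distinct[of g g' "i' - i"] g K by auto
  qed
  then have "card (K \<times> ?I) = card (?f ` (K \<times> ?I))" by (simp add: card_image)
  also have "\<dots> \<le> complexity Z n"
    unfolding complexity_def using sub
    by (intro card_mono finite_words[OF Z]) (auto intro: window_in_words)
  finally have "card K * card ?I \<le> complexity Z n" by (simp add: card_cartesian_product)
  then have "real (card K) * real (card ?I) \<le> real (complexity Z n)"
    by (metis of_nat_le_iff of_nat_mult)
  moreover have "real n - real_of_int (int G + 2 * ?L) \<le> real (card ?I)"
    by simp
  ultimately show ?thesis
    by (meson mult_left_mono of_nat_0_le_iff order_trans)
qed

text \<open>A word of \<open>bridge g\<close> long enough to isolate it forces \<open>bridge g\<close> into every subshift that contains the word.\<close>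

lemma bridge_persists:
  assumes Z: "subshift Z" "Z \<subseteq> bridged gaps" and g: "g \<in> gaps" "bridge g \<in> Y"
    and m: "words m Z = words m Y" "int m \<ge> int g + 2 * (l + memory)"
  shows "bridge g \<in> Z"
proof -
  have "window m (bridge g) (- l - memory) \<in> words m Z"
    using window_in_words[OF g(2)] m(1) by blast
  then obtain x where x: "x \<in> Z" "window m x (- l - memory) = window m (bridge g) (- l - memory)"
    using word_occurs_at[OF Z(1)] by metis
  have "x = bridge g"
  proof (rule bridge_isolated[OF g(1)])
    show "x \<in> bridged gaps" using x Z by blast
    show "x i = bridge g i" if "- l - memory \<le> i" "i < int g + l + memory" for i
      using window_eqD[OF x(2), of i] that m(2) by simp
  qed
  then show ?thesis using x by simp
qed

text \<open>Of the bridges in \<open>bridged K\<close>, \<open>N\<close> many persist in every subshift with the same words of length \<open>m\<close>, and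
  each contributes its own words.\<close>

theorem nearby_superlinear:
  assumes K: "K \<subseteq> gaps" "infinite K"
  shows "\<exists>m. \<forall>Z. subshift Z \<and> words m Z = words m (bridged K) \<longrightarrow>
    Z \<subseteq> bridged gaps \<and> (\<exists>c. \<forall>n. real N * (real n - c) \<le> real (complexity Z n))"
proof -
  have "infinite (K - {..<nat q})" using K by simp
  then obtain K0 where K0: "K0 \<subseteq> K - {..<nat q}" "card K0 = N" "finite K0"
    using infinite_arbitrarily_large by blast
  define G where "G = Max (insert 0 K0)"
  have G: "g \<le> G" if "g \<in> K0" for g using that K0(3) by (simp add: G_def)
  define m where "m = Suc (nat memory) + (G + 2 * nat (l + memory))"
  have "Z \<subseteq> bridged gaps \<and> (\<exists>c. \<forall>n. real N * (real n - c) \<le> real (complexity Z n))"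
    if Z: "subshift Z" "words m Z = words m (bridged K)" for Z
  proof -
    have sub: "Z \<subseteq> bridged gaps"
      using words_eq_shorter[OF Z(2)] by (intro nearby_subset[OF K(1)]) (simp add: m_def)
    have "bridge g \<in> Z" if "g \<in> K0" for g
    proof (rule bridge_persists[OF Z(1) sub _ _ Z(2)])
      show "g \<in> gaps" "bridge g \<in> bridged K" using that K0 K bridge_in_bridged by auto
      show "int g + 2 * (l + memory) \<le> int m" using G[OF that] by (simp add: m_def)
    qed
    then have "real (card K0) * (real n - real_of_int (int G + 2 * (l + memory))) \<le> real (complexity Z n)" for n
      using K0 K G by (intro complexity_ge[OF Z(1)]) auto
    then show ?thesis using sub K0(2) by blast
  qed
  then show ?thesis by blast
qed

text \<open>Removing from \<open>K\<close> all gaps \<open>\<ge> n\<close> keeps the words of length \<open>n\<close>, but it is a real change: with finitely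
  many bridges the complexity is linear, with infinitely many it is superlinear.\<close>

theorem bridged_nonisolated:
  assumes K: "K \<subseteq> gaps" "infinite K"
  shows "bridged K \<in> nonisolated"
proof (rule nonisolatedI)
  show "subshift (bridged K)" using subshift_bridged K by blast
  fix n
  \<comment> \<open>\<open>growth + n\<close> bounds the slope of the complexity with at most \<open>n\<close> bridges.\<close>
  let ?K = "{g\<in>K. g < n}" and ?N = "Suc (growth + n)"
  have K': "?K \<subseteq> gaps" using K by blast
  have "words n (bridged K) \<subseteq> words n (bridged ?K)"
  proof
    fix w assume "w \<in> words n (bridged K)"
    then obtain y i where y: "y \<in> bridged K" "w = window n y i" by (auto simp: words_alt)
    from y(1) show "w \<in> words n (bridged ?K)"
    proof (cases rule: bridged_cases)
      case 1
      then show ?thesis using y P_subset_bridged window_in_words by blast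
    next
      case (2 t k)
      then show ?thesis using y orbit_subset_bridged(1) window_in_words by blast
    next
      case (3 g k)
      then have g: "g \<in> gaps" using K by blast
      consider "g < n" | "i + k + int n \<le> int g" | "i + k \<ge> 0" by linarith
      then show ?thesis
      proof cases
        case 1
        then show ?thesis using 3 y orbit_subset_bridged(2)[of g ?K] window_in_words by blast
      next
        case 2
        then have "w = window n (translate (i + k) u) 0" using y 3 bridge_window(1)[OF g] by simp
        then show ?thesis using orbit_subset_bridged(1)[of u] window_in_words by blast
      next
        case c: 3
        then have "w = window n (translate (i + k - int g) v) 0" using y 3 bridge_window(2)[OF g] by simp
        then show ?thesis using orbit_subset_bridged(1)[of v] window_in_words by blast
      qed
    qed
  qed
  moreover have "words n (bridged ?K) \<subseteq> words n (bridged K)"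
    by (intro words_mono bridged_mono) auto
  moreover have "bridged ?K \<noteq> bridged K"
  proof
    assume eq: "bridged ?K = bridged K"
    obtain c where c: "\<And>m. real ?N * (real m - c) \<le> real (complexity (bridged K) m)"
      using nearby_superlinear[OF K, of ?N] subshift_bridged[OF K(1)] by blast
    obtain m where m: "real m > real ?N * \<bar>c\<bar> + real growth" using reals_Archimedean2 by blast
    have "card {g\<in>?K. g < m} \<le> card {..<n}" by (rule card_mono) auto
    then have "card {g\<in>?K. g < m} * m \<le> n * m" by simp
    then have "complexity (bridged K) m \<le> growth * Suc m + n * m"
      using complexity_bridged_le[OF K', of m] unfolding eq by linarith
    then have "real (complexity (bridged K) m) \<le> real (growth * Suc m + n * m)" by linarith
    then have "real (complexity (bridged K) m) \<le> real growth * (real m + 1) + real n * real m"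
      by (simp add: algebra_simps)
    then have "real ?N * (real m - c) \<le> real growth * (real m + 1) + real n * real m"
      using c order_trans by blast
    then have "real m \<le> real ?N * c + real growth" by (simp add: algebra_simps)
    also have "\<dots> \<le> real ?N * \<bar>c\<bar> + real growth" by (simp add: mult_left_mono)
    finally show False using m by linarith
  qed
  ultimately show "\<exists>Y. subshift Y \<and> words n Y = words n (bridged K) \<and> Y \<noteq> bridged K"
    using subshift_bridged[OF K'] by blast
qed

end

section \<open>Reachability of words in a shift of finite type\<close>

lemma common_period:
  fixes F :: "(int \<Rightarrow> 'a) set"
  assumes "finite F" "\<And>p. p \<in> F \<Longrightarrow> \<exists>d>0. \<forall>i. p (i + d) = p i"
  shows "\<exists>q>0. \<forall>p\<in>F. \<forall>i. p (i + q) = p i"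
  using assms
proof (induction F rule: finite_induct)
  case empty
  show ?case by (intro exI[of _ 1]) simp
next
  case (insert p F)
  then obtain q where q: "q > 0" "\<forall>p\<in>F. \<forall>i. p (i + q) = p i" by auto
  obtain d where d: "d > 0" "\<forall>i. p (i + d) = p i" using insert.prems by blast
  have "x (i + q * d) = x i" if "x \<in> insert p F" for x i
  proof (cases "x = p")
    case True
    then show ?thesis using periodic_mult[of p d i q] d by simp
  next
    case False
    then show ?thesis using periodic_mult[of x q i d] q that by (simp add: mult.commute)
  qed
  then show ?case using q d by (intro exI[of _ "q * d"]) auto
qed

text \<open>The sequence \<open>x\<close> before time \<open>i\<close>, continued with \<open>y\<close> from its time \<open>j\<close> on.\<close>

definition join :: "(int \<Rightarrow> int) \<Rightarrow> int \<Rightarrow> (int \<Rightarrow> int) \<Rightarrow> int \<Rightarrow> int \<Rightarrow> int" where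
  "join x i y j = (\<lambda>k. if k < i then x k else y (k - i + j))"

lemma window_join_left:
  assumes "window n x i = window n y j" "k \<le> i"
  shows "window n (join x i y j) k = window n x k"
proof (rule window_eqI)
  fix m assume m: "k \<le> m" "m < k + int n"
  show "join x i y j m = x (m - k + k)"
    using window_eqD[OF assms(1), of m] m assms(2) by (auto simp: join_def)
qed

lemma window_join_right:
  "k \<ge> i \<Longrightarrow> window n (join x i y j) k = window n y (k - i + j)"
  by (rule window_eqI) (simp add: join_def algebra_simps)

text \<open>\<open>V\<close> plays the role of the words of length \<open>n\<close> of a subshift. The words are the vertices of a finite graph
  whose bi-infinite paths are the points of the shift of finite type \<open>sft\<close> below; the windows of a point are the vertices on its path.\<close>

locale word_graph =
  fixes V :: "int list set" and n :: nat
  assumes n_pos: "n > 0" and finite_V: "finite V"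
    and extends: "s \<in> V \<Longrightarrow> \<exists>z. (\<forall>i. window n z i \<in> V) \<and> window n z 0 = s"
begin

definition sft :: "(int \<Rightarrow> int) set" where "sft = {z. \<forall>i. window n z i \<in> V}"

definition reach :: "int list \<Rightarrow> int list \<Rightarrow> bool" where
  "reach s s' \<longleftrightarrow> (\<exists>z\<in>sft. \<exists>i j. i \<le> j \<and> window n z i = s \<and> window n z j = s')"

definition cyclic :: "(int \<Rightarrow> int) \<Rightarrow> bool" where
  "cyclic p \<longleftrightarrow> p \<in> sft \<and> (\<exists>d>0. \<forall>k. p (k + d) = p k)"

definition minimal :: "int list \<Rightarrow> bool" where
  "minimal s \<longleftrightarrow> s \<in> V \<and> (\<forall>s'. reach s' s \<longrightarrow> reach s s')"

definition maximal :: "int list \<Rightarrow> bool" where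
  "maximal s \<longleftrightarrow> s \<in> V \<and> (\<forall>s'. reach s s' \<longrightarrow> reach s' s)"

lemma sft_window: "z \<in> sft \<Longrightarrow> window n z i \<in> V"
  by (simp add: sft_def)

lemma sft_translate: "z \<in> sft \<Longrightarrow> translate k z \<in> sft"
  by (simp add: sft_def)

lemma cyclic_translate: "cyclic p \<Longrightarrow> cyclic (translate k p)"
  unfolding cyclic_def using sft_translate by (fastforce simp: algebra_simps)

lemma cyclic_sft: "cyclic p \<Longrightarrow> p \<in> sft"
  by (simp add: cyclic_def)

lemma join_sft:
  assumes "x \<in> sft" "y \<in> sft" "window n x i = window n y j"
  shows "join x i y j \<in> sft"
  unfolding sft_def
proof (intro CollectI allI)
  fix k show "window n (join x i y j) k \<in> V"
    using window_join_left[OF assms(3), of k] window_join_right[of i k n x y j]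
      sft_window[OF assms(1)] sft_window[OF assms(2)] by (cases "k \<le> i") auto
qed

lemma reachI: "z \<in> sft \<Longrightarrow> i \<le> j \<Longrightarrow> reach (window n z i) (window n z j)"
  unfolding reach_def by blast

lemma reach_refl: "s \<in> V \<Longrightarrow> reach s s"
  using extends[of s] unfolding reach_def sft_def by blast

lemma reach_V: "reach s s' \<Longrightarrow> s \<in> V \<and> s' \<in> V"
  using sft_window by (auto simp: reach_def)

lemma reach_trans:
  assumes "reach s s'" "reach s' s''" shows "reach s s''"
proof -
  obtain x i j where x: "x \<in> sft" "i \<le> j" "window n x i = s" "window n x j = s'"
    using assms(1) by (auto simp: reach_def)
  obtain y k l where y: "y \<in> sft" "k \<le> l" "window n y k = s'" "window n y l = s''"
    using assms(2) by (auto simp: reach_def)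
  have eq: "window n x j = window n y k" using x y by simp
  have "join x j y k \<in> sft" using join_sft x y eq by blast
  moreover have "window n (join x j y k) i = s" using window_join_left[OF eq x(2)] x by simp
  moreover have "window n (join x j y k) (j + (l - k)) = s''"
    using window_join_right[of j "j + (l - k)" n x y k] y by simp
  moreover have "i \<le> j + (l - k)" using x y by simp
  ultimately show ?thesis unfolding reach_def by blast
qed

text \<open>Repeating the part of \<open>z\<close> between two equal windows gives a periodic point with windows from \<open>z\<close> only.\<close>

lemma periodize:
  assumes z: "z \<in> sft" "i < j" "window n z i = window n z j"
  obtains p where "cyclic p" "\<And>k. i \<le> k \<Longrightarrow> k < j + int n \<Longrightarrow> p k = z k"
proof -
  define d where "d = j - i"
  define p where "p k = z (i + (k - i) mod d)" for k
  have d: "d > 0" using z(2) by (simp add: d_def)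
  have per: "p (k + d) = p k" for k
  proof -
    have "(k + d - i) mod d = (k - i) mod d"
      using mod_add_self2[of "k - i" d] by (simp add: algebra_simps)
    then show ?thesis by (simp add: p_def)
  qed
  have agree: "p k = z k" if "i \<le> k" "k < j + int n" for k
    using that
  proof (induction "nat (k - i)" arbitrary: k rule: less_induct)
    case less
    show ?case
    proof (cases "k < j")
      case True
      then show ?thesis using less(2) by (simp add: p_def d_def)
    next
      case False
      have "p k = p (k - d)" using per[of "k - d"] by simp
      also have "\<dots> = z (k - d)" using less False d by (intro less(1)) (auto simp: d_def)
      also have "\<dots> = z k"
        using window_eqD[OF z(3), of "k - d"] less False by (simp add: d_def)
      finally show ?thesis .
    qed
  qed
  have "window n p k \<in> V" for k
  proof -
    define k' where "k' = i + (k - i) mod d"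
    have k': "i \<le> k'" "k' < j" using d pos_mod_bound[OF d, of "k - i"] pos_mod_sign[OF d, of "k - i"]
      by (simp_all add: k'_def) (simp add: d_def)
    have "window n p k = window n p k'"
    proof (rule window_eqI)
      fix m assume "k \<le> m" "m < k + int n"
      have "p (m - k + k') = p ((m - k + i) + ((k - i) mod d))" by (simp add: k'_def algebra_simps)
      also have "\<dots> = p ((m - k + i) + ((m - (m - k + i)) mod d))" by (simp add: algebra_simps)
      also have "\<dots> = p m" by (rule periodic_mod) (rule per)
      finally show "p m = p (m - k + k')" by simp
    qed
    also have "\<dots> = window n z k'" using k' by (intro window_eqI) (simp add: agree)
    finally show ?thesis using sft_window z by simp
  qed
  then have "cyclic p" unfolding cyclic_def sft_def using per d by blast
  then show ?thesis using that agree by blast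
qed

text \<open>Follow \<open>z\<close> from \<open>i\<close> to \<open>j\<close>, return to the window at \<open>i\<close>, and periodize.\<close>

lemma close_loop:
  assumes z: "z \<in> sft" "i < j" "reach (window n z j) (window n z i)"
  obtains p where "cyclic p" "\<And>k. i \<le> k \<Longrightarrow> k < j + int n \<Longrightarrow> p k = z k"
proof -
  obtain x a c where x: "x \<in> sft" "a \<le> c" "window n x a = window n z j" "window n x c = window n z i"
    using z(3) by (auto simp: reach_def)
  let ?y = "join z j x a"
  have left: "window n ?y k = window n z k" if "k \<le> j" for k
    using window_join_left[of n z j x a k] x that by simp
  have "window n ?y (j + (c - a)) = window n z i"
    using window_join_right[of j "j + (c - a)" n z x a] x by simp
  then have "window n ?y i = window n ?y (j + (c - a))" using left[of i] z by simp
  moreover have "?y \<in> sft" using join_sft z x by simp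
  ultimately obtain p where p: "cyclic p" "\<And>k. i \<le> k \<Longrightarrow> k < j + (c - a) + int n \<Longrightarrow> p k = ?y k"
    using periodize[of ?y i "j + (c - a)"] z x by auto
  have "p k = z k" if "i \<le> k" "k < j + int n" for k
  proof -
    have "p k = ?y k" using p(2) that x(2) by simp
    also have "\<dots> = z k"
      using window_eqD[OF left[of j], of k] that by (cases "k < j") (auto simp: join_def)
    finally show ?thesis .
  qed
  then show ?thesis using that p by blast
qed

lemma cyclic_reach:
  assumes "cyclic p" shows "reach (window n p i) (window n p j)"
proof -
  obtain d where d: "d > 0" "\<And>k. p (k + d) = p k" using assms by (auto simp: cyclic_def)
  have "window n p j = window n p (j + \<bar>j - i\<bar> * d)"
    by (rule window_eqI) (simp add: periodic_mult[of p d, OF d(2)] add.assoc[symmetric])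
  moreover have "\<bar>j - i\<bar> * d \<ge> \<bar>j - i\<bar>"
    using d(1) mult_left_mono[of 1 d "\<bar>j - i\<bar>"] by simp
  then have "i \<le> j + \<bar>j - i\<bar> * d" by linarith
  ultimately show ?thesis using reachI cyclic_sft[OF assms] by metis
qed

lemma minimal_equiv: "minimal s \<Longrightarrow> reach s' s \<Longrightarrow> minimal s'"
  unfolding minimal_def using reach_trans reach_V by blast

lemma maximal_equiv: "maximal s \<Longrightarrow> reach s s' \<Longrightarrow> maximal s'"
  unfolding maximal_def using reach_trans reach_V by blast

lemma cyclic_at:
  assumes "cyclic p" "window n p k = s" obtains p' where "cyclic p'" "window n p' 0 = s"
  using that[of "translate k p"] cyclic_translate[OF assms(1)] assms(2) by simp

text \<open>The word just before \<open>s\<close> reaches \<open>s\<close>, so by minimality it is reached from \<open>s\<close>, which closes a loop.\<close>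

lemma minimal_cyclic:
  assumes "minimal s" obtains p where "cyclic p" "window n p 0 = s"
proof -
  obtain z where z: "z \<in> sft" "window n z 0 = s"
    using assms extends[of s] by (auto simp: minimal_def sft_def)
  have "reach (window n z (-1)) s" using reachI[OF z(1), of "-1" 0] z(2) by simp
  then have "reach (window n z 0) (window n z (-1))" using assms z(2) by (simp add: minimal_def)
  then obtain p where p: "cyclic p" "\<And>k. -1 \<le> k \<Longrightarrow> k < 0 + int n \<Longrightarrow> p k = z k"
    using close_loop[OF z(1), of "-1" 0] by auto
  then have "window n p 0 = window n z 0" by (intro window_eqI) auto
  then show ?thesis using that p z by blast
qed

lemma maximal_cyclic:
  assumes "maximal s" obtains p where "cyclic p" "window n p 0 = s"
proof -
  obtain z where z: "z \<in> sft" "window n z 0 = s"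
    using assms extends[of s] by (auto simp: maximal_def sft_def)
  have "reach s (window n z 1)" using reachI[OF z(1), of 0 1] z(2) by simp
  then have "reach (window n z 1) (window n z 0)" using assms z(2) by (simp add: maximal_def)
  then obtain p where p: "cyclic p" "\<And>k. 0 \<le> k \<Longrightarrow> k < 1 + int n \<Longrightarrow> p k = z k"
    using close_loop[OF z(1), of 0 1] by auto
  then have "window n p 0 = window n z 0" by (intro window_eqI) auto
  then show ?thesis using that p z by blast
qed

text \<open>Every step to a strictly smaller word shrinks the finite set of words below it.\<close>

lemma ex_minimal:
  assumes "s \<in> V" shows "\<exists>a. minimal a \<and> reach a s"
  using assms
proof (induction "card {s'. reach s' s}" arbitrary: s rule: less_induct)
  case less
  show ?case
  proof (cases "minimal s")
    case True
    then show ?thesis using reach_refl less.prems by blast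
  next
    case False
    then obtain s' where s': "reach s' s" "\<not> reach s s'" using less.prems by (auto simp: minimal_def)
    have "finite {t. reach t s}" using finite_V reach_V by (auto intro: finite_subset)
    moreover have "{t. reach t s'} \<subset> {t. reach t s}"
      using s' reach_trans reach_refl[OF less.prems] by blast
    ultimately have "card {t. reach t s'} < card {t. reach t s}" by (rule psubset_card_mono)
    then obtain a where "minimal a" "reach a s'" using less.hyps reach_V s'(1) by blast
    then show ?thesis using reach_trans s'(1) by blast
  qed
qed

lemma ex_maximal:
  assumes "s \<in> V" shows "\<exists>a. maximal a \<and> reach s a"
  using assms
proof (induction "card {s'. reach s s'}" arbitrary: s rule: less_induct)
  case less
  show ?case
  proof (cases "maximal s")
    case True
    then show ?thesis using reach_refl less.prems by blast
  next
    case False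
    then obtain s' where s': "reach s s'" "\<not> reach s' s" using less.prems by (auto simp: maximal_def)
    have "finite {t. reach s t}" using finite_V reach_V by (auto intro: finite_subset)
    moreover have "{t. reach s' t} \<subset> {t. reach s t}"
      using s' reach_trans reach_refl[OF less.prems] by blast
    ultimately have "card {t. reach s' t} < card {t. reach s t}" by (rule psubset_card_mono)
    then obtain a where "maximal a" "reach s' a" using less.hyps reach_V s'(1) by blast
    then show ?thesis using reach_trans s'(1) by blast
  qed
qed

lemma connect:
  assumes p: "p \<in> sft" "p' \<in> sft" and r: "reach (window n p 0) s" "reach s (window n p' 0)"
  shows "\<exists>t\<in>sft. \<exists>l\<ge>0. (\<forall>k<0. t k = p k) \<and> (\<forall>k\<ge>l. t k = p' (k - l)) \<and> (\<exists>j. window n t j = s)"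
proof -
  obtain y i j where y: "y \<in> sft" "i \<le> j" "window n y i = window n p 0" "window n y j = s"
    using r(1) by (auto simp: reach_def)
  obtain z a c where z: "z \<in> sft" "a \<le> c" "window n z a = s" "window n z c = window n p' 0"
    using r(2) by (auto simp: reach_def)
  define x where "x = join p 0 y i"
  define m where "m = j - i"
  have x: "x \<in> sft" "window n x m = s"
    using join_sft p y window_join_right[of 0 m n p y i] by (auto simp: x_def m_def)
  define x' where "x' = join x m z a"
  define l where "l = m + (c - a)"
  have eq: "window n x m = window n z a" using x z by simp
  have x': "x' \<in> sft" "window n x' m = s" "window n x' l = window n p' 0"
    using join_sft[OF x(1) z(1) eq] window_join_left[OF eq, of m] x z
      window_join_right[of m l n x z a] by (auto simp: x'_def l_def)
  define t where "t = join x' l p' 0"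
  have ml: "0 \<le> m" "m \<le> l" using y z by (auto simp: m_def l_def)
  have "t \<in> sft" "window n t m = s"
    using join_sft[OF x'(1) p(2) x'(3)] window_join_left[OF x'(3), of m] x' ml by (auto simp: t_def)
  moreover have "\<forall>k<0. t k = p k" "\<forall>k\<ge>l. t k = p' (k - l)"
    using ml by (auto simp: t_def x'_def x_def join_def)
  ultimately show ?thesis using ml by (intro bexI[of _ t] exI[of _ l]) auto
qed

text \<open>With \<open>d\<close> a common period, go \<open>k\<close> times along \<open>p\<close> and once along \<open>p'\<close>, for a time \<open>d\<close> each. Different \<open>k\<close> give
  different points, since the excursion along \<open>p'\<close> starts at time \<open>k * d\<close>.\<close>

lemma infinitely_many_cyclic:
  assumes p: "cyclic p" "cyclic p'" "p \<noteq> p'" and s: "window n p 0 = s" "window n p' 0 = s"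
  shows "infinite {x. cyclic x \<and> window n x 0 = s}"
proof -
  have "\<exists>q>0. \<forall>x\<in>{p, p'}. \<forall>i. x (i + q) = x i"
    by (rule common_period) (use p in \<open>auto simp: cyclic_def\<close>)
  then obtain d where d: "d > 0" "\<And>i. p (i + d) = p i" "\<And>i. p' (i + d) = p' i" by auto
  have ex: "\<exists>x. cyclic x \<and> window n x 0 = s \<and> (\<forall>i. 0 \<le> i \<and> i < int k * d \<longrightarrow> x i = p i) \<and>
      (\<forall>i. int k * d \<le> i \<and> i < int k * d + d \<longrightarrow> x i = p' i)" for k :: nat
  proof -
    define m where "m = int k * d"
    have m: "m \<ge> 0" using d by (simp add: m_def)
    have eq: "window n p m = window n p' 0"
    proof -
      have "window n p m = window n p 0"
      proof (rule window_eqI)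
        fix i show "p i = p (i - m + 0)"
          using periodic_mult[of p d "i - m" "int k", OF d(2)] by (simp add: m_def)
      qed
      then show ?thesis using s by simp
    qed
    let ?y = "join p m p' 0"
    have y: "?y \<in> sft" using join_sft cyclic_sft p eq by blast
    have y0: "window n ?y 0 = s" using window_join_left[OF eq m] s by simp
    have "window n ?y (m + d) = window n p' d" using window_join_right[of m "m + d" n p p' 0] d by simp
    also have "\<dots> = s" unfolding s(2)[symmetric] 
    proof (rule window_eqI)
      fix i show "p' i = p' (i - d + 0)" using d(3)[of "i - d"] by simp
    qed
    finally obtain x where x: "cyclic x" "\<And>i. 0 \<le> i \<Longrightarrow> i < m + d + int n \<Longrightarrow> x i = ?y i"
      using periodize[of ?y 0 "m + d"] y y0 m d by auto
    have "window n x 0 = window n ?y 0" using x(2) m d by (intro window_eqI) auto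
    moreover have "x i = p i" if "0 \<le> i" "i < m" for i using x(2)[of i] that d by (simp add: join_def)
    moreover have "x i = p' i" if "m \<le> i" "i < m + d" for i
      using x(2)[of i] that m periodic_mult[of p' d i "- int k", OF d(3)] by (simp add: join_def m_def)
    ultimately show ?thesis using x(1) y0 unfolding m_def by blast
  qed
  then obtain x where x: "\<And>k. cyclic (x k) \<and> window n (x k) 0 = s"
    "\<And>k i. 0 \<le> i \<Longrightarrow> i < int k * d \<Longrightarrow> x k i = p i"
    "\<And>k i. int k * d \<le> i \<Longrightarrow> i < int k * d + d \<Longrightarrow> x k i = p' i" by metis
  have "x k \<noteq> x k'" if "k < k'" for k k'
  proof
    assume eq: "x k = x k'"
    have "p = p'"
    proof (rule periodic_eqI[where q = d and j = "int k * d"])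
      fix i assume i: "int k * d \<le> i" "i < int k * d + d"
      have "int k' * d \<ge> (int k + 1) * d" using that d by (intro mult_right_mono) auto
      then have "i < int k' * d" using i by (simp add: algebra_simps)
      moreover have "0 \<le> int k * d" using d by simp
      then have "0 \<le> i" using i by linarith
      ultimately show "p i = p' i" using x(2)[of i k'] x(3)[of k i] i eq by simp
    qed (use d in auto)
    then show False using p by simp
  qed
  then have "inj x" by (metis injI linorder_neqE_nat)
  then have "infinite (range x)" by (rule range_inj_infinite)
  moreover have "range x \<subseteq> {x. cyclic x \<and> window n x 0 = s}" using x(1) by blast
  ultimately show ?thesis using infinite_super by blast
qed

section \<open>Shifts of finite type with finitely many orbits\<close>

text \<open>A window repeats within any \<open>card V + 1\<close> consecutive positions, and repeated windows are minimal or
  maximal. So a point stays in one class of minimal words, changes within a bounded time, and stays in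
  one class of maximal words from then on (or stays in one class all the time). Inside a class it
  must follow the unique periodic point through its current word. Up to translation it is therefore
  determined by a window that covers the change.\<close>

lemma finitely_many_orbits:
  assumes ends: "\<And>p. cyclic p \<Longrightarrow> minimal (window n p 0) \<or> maximal (window n p 0)"
    and unique: "\<And>p p'. cyclic p \<Longrightarrow> cyclic p' \<Longrightarrow> window n p 0 = window n p' 0 \<Longrightarrow> p = p'"
  shows "\<exists>F. finite F \<and> sft \<subseteq> \<Union>(orbit ` F)"
proof -
  define N where "N = int (card V) + 1"
  have unique': "p = p'" if "cyclic p" "cyclic p'" "window n p i = window n p' i" for p p' i
  proof -
    have "translate i p = translate i p'"
      using that by (intro unique cyclic_translate) simp_all
    then have "translate (-i) (translate i p) = translate (-i) (translate i p')" by simp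
    then show ?thesis by simp
  qed
  have hit: "\<exists>k. i \<le> k \<and> k < i + N \<and> (minimal (window n z k) \<or> maximal (window n z k))"
    if z: "z \<in> sft" for z i
  proof -
    have "card ((\<lambda>k. window n z k) ` {i..<i + N}) \<le> card V"
      using sft_window[OF z] by (intro card_mono finite_V) auto
    also have "\<dots> < card {i..<i + N}" by (simp add: N_def)
    finally have "\<not> inj_on (\<lambda>k. window n z k) {i..<i + N}" using card_image by fastforce
    then obtain k k' where k: "k \<in> {i..<i + N}" "k' \<in> {i..<i + N}" "k < k'" "window n z k = window n z k'"
      unfolding inj_on_def by (metis linorder_neqE_linordered_idom)
    obtain p where p: "cyclic p" "\<And>m. k \<le> m \<Longrightarrow> m < k' + int n \<Longrightarrow> p m = z m"
      using periodize[OF z k(3,4)] by blast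
    have "window n p k = window n z k" using p(2) k(3) by (intro window_eqI) auto
    then have "minimal (window n z k) \<or> maximal (window n z k)"
      using ends cyclic_at[OF p(1)] by metis
    then show ?thesis using k by auto
  qed
  \<comment> \<open>The change of class, if there is one, takes place between \<open>0\<close> and \<open>N\<close>.\<close>
  define centred where "centred z \<longleftrightarrow> (\<forall>j\<le>0. reach (window n z 0) (window n z j)) \<and>
    (\<forall>j\<ge>N. reach (window n z j) (window n z N))" for z
  have centre: "\<exists>i. centred (translate i z)" if z: "z \<in> sft" for z
  proof -
    have down: "minimal (window n z j)" "reach (window n z k) (window n z j)"
      if "minimal (window n z k)" "j \<le> k" for j k
      using that minimal_equiv[OF that(1)] reachI[OF z that(2)] unfolding minimal_def by blast+
    have up: "maximal (window n z j)" "reach (window n z j) (window n z k)"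
      if "maximal (window n z k)" "k \<le> j" for j k
      using that maximal_equiv[OF that(1)] reachI[OF z that(2)] unfolding maximal_def by blast+
    have "\<exists>i. (\<forall>j\<le>i. reach (window n z i) (window n z j)) \<and>
        (\<forall>j\<ge>i + N. reach (window n z j) (window n z (i + N)))"
    proof -
      consider "\<forall>k. minimal (window n z k)" | "\<forall>k. \<not> minimal (window n z k)"
        | k k' where "minimal (window n z k)" "\<not> minimal (window n z k')" by blast
      then show ?thesis
      proof cases
        case 1
        then show ?thesis using down(2) by blast
      next
        case 2
        have "maximal (window n z k)" for k
        proof -
          obtain k' where "k - N \<le> k'" "k' < k - N + N" "maximal (window n z k')"
            using hit[OF z, of "k - N"] 2 by blast
          then show ?thesis using up(1)[of k' k] by simp
        qed
        then show ?thesis using up(2) by blast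
      next
        case (3 k k')
        define M where "M = {i\<in>{k..k'}. minimal (window n z i)}"
        have "k < k'" using 3 down(1)[of k k'] by (meson not_le)
        have "M \<subseteq> {k..k'}" by (auto simp: M_def)
        then have fin: "finite M" using finite_subset by blast
        have "k \<in> M" using 3 \<open>k < k'\<close> by (simp add: M_def)
        define i where "i = Max M"
        have i: "i \<in> M" unfolding i_def using fin \<open>k \<in> M\<close> by (intro Max_in) auto
        have above: "\<not> minimal (window n z j)" if "j > i" for j
        proof
          assume min: "minimal (window n z j)"
          then have "j < k'" using 3(2) down(1)[of j k'] by (meson not_le)
          then have "j \<in> M" using that i min by (auto simp: M_def)
          then show False using Max_ge[OF fin] that by (fastforce simp: i_def)
        qed
        obtain m where "i + 1 \<le> m" "m < i + 1 + N" "maximal (window n z m)"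
          using hit[OF z, of "i + 1"] above by force
        then have "maximal (window n z (i + N))" using up(1)[of m "i + N"] by simp
        moreover have "minimal (window n z i)" using i by (simp add: M_def)
        ultimately show ?thesis using down(2) up(2) by blast
      qed
    qed
    then obtain i where i: "\<forall>j\<le>i. reach (window n z i) (window n z j)"
      "\<forall>j\<ge>i + N. reach (window n z j) (window n z (i + N))" by blast
    have "centred (translate i z)"
      using i by (auto simp: centred_def algebra_simps)
    then show ?thesis by blast
  qed
  define H where "H = {z\<in>sft. centred z}"
  define m where "m = nat N + n"
  have inj: "inj_on (\<lambda>z. window m z 0) H"
  proof (rule inj_onI)
    fix z z' assume z: "z \<in> H" "z' \<in> H" and "window m z 0 = window m z' 0"
    then have mid: "z k = z' k" if "0 \<le> k" "k < N + int n" for k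
      using window_eqD[of m z 0 z' 0 k] that by (simp add: m_def N_def)
    obtain p where p: "cyclic p" "\<And>k. N \<le> k \<Longrightarrow> k < N + 1 + int n \<Longrightarrow> p k = z k"
      using close_loop[of z N "N + 1"] z by (auto simp: H_def centred_def)
    have right: "x k = p k" if x: "x \<in> H" "window n x N = window n p N" and k: "k \<ge> N" for x k
    proof -
      obtain p' where p': "cyclic p'" "\<And>i. N \<le> i \<Longrightarrow> i < k + 1 + int n \<Longrightarrow> p' i = x i"
        using close_loop[of x N "k + 1"] x k by (auto simp: H_def centred_def)
      have "window n p' N = window n x N" using p'(2) k by (intro window_eqI) auto
      then have "p' = p" using unique'[OF p'(1) p(1), of N] x by simp
      then show ?thesis using p'(2)[of k] k by simp
    qed
    obtain r where r: "cyclic r" "\<And>k. -1 \<le> k \<Longrightarrow> k < 0 + int n \<Longrightarrow> r k = z k"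
      using close_loop[of z "-1" 0] z by (auto simp: H_def centred_def)
    have left: "x k = r k" if x: "x \<in> H" "window n x 0 = window n r 0" and k: "k < 0" for x k
    proof -
      obtain p' where p': "cyclic p'" "\<And>i. k \<le> i \<Longrightarrow> i < 0 + int n \<Longrightarrow> p' i = x i"
        using close_loop[of x k 0] x k by (auto simp: H_def centred_def)
      have "window n p' 0 = window n x 0" using p'(2) k by (intro window_eqI) auto
      then have "p' = r" using unique'[OF p'(1) r(1), of 0] x by simp
      then show ?thesis using p'(2)[of k] k by simp
    qed
    have w: "window n z N = window n p N" "window n z 0 = window n r 0"
      "window n z' N = window n p N" "window n z' 0 = window n r 0"
      using p(2) r(2) mid by (auto intro!: window_eqI simp: N_def)
    show "z = z'"
    proof
      fix k
      consider "k < 0" | "0 \<le> k" "k < N" | "k \<ge> N" by linarith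
      then show "z k = z' k"
        using left[OF z(1) w(2)] left[OF z(2) w(4)] right[OF z(1) w(1)] right[OF z(2) w(3)] mid
        by cases auto
    qed
  qed
  have letter: "z k \<in> hd ` V" if "z \<in> sft" for z k
  proof -
    have "hd (window n z k) = z k" using n_pos by (simp add: window_def hd_map)
    then show ?thesis using sft_window[OF that, of k] by (metis imageI)
  qed
  have "(\<lambda>z. window m z 0) ` H \<subseteq> {w. set w \<subseteq> hd ` V \<and> length w = m}"
    using letter by (auto simp: H_def window_def)
  then have "finite ((\<lambda>z. window m z 0) ` H)"
    using finite_lists_length_eq[of "hd ` V" m] finite_V finite_subset by blast
  then have "finite H" using inj by (rule finite_imageD)
  moreover have "sft \<subseteq> \<Union>(orbit ` H)"
  proof
    fix z assume z: "z \<in> sft"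
    then obtain i where "centred (translate i z)" using centre by blast
    then have "translate i z \<in> H" using z sft_translate by (simp add: H_def)
    moreover have "z \<in> orbit (translate i z)"
      unfolding orbit_eq_range by (intro image_eqI[of _ _ "-i"]) simp_all
    ultimately show "z \<in> \<Union>(orbit ` H)" by blast
  qed
  ultimately show ?thesis by blast
qed

end

section \<open>Skeletons near a non-isolated subshift\<close>

context word_graph
begin

text \<open>Sources are periodic points through minimal words, sinks are periodic points through words that are
  maximal but not minimal. A word that is both minimal and maximal lies on a source, and every other
  word is crossed by a transition from a source to a sink. In the first case of the assumption, \<open>b\<close> is
  the given point. In the second case, \<open>b\<close> and one more sink \<open>c\<close> are new periodic points through the
  branching word; taking \<open>c\<close> to be new covers the case that the class of this word is minimal and
  maximal at once, where no sink is reachable from it otherwise.\<close>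

lemma skeleton_exists:
  assumes rich: "(\<exists>p. cyclic p \<and> \<not> minimal (window n p 0) \<and> \<not> maximal (window n p 0)) \<or>
    (\<exists>p p'. cyclic p \<and> cyclic p' \<and> window n p 0 = window n p' 0 \<and> p \<noteq> p')"
  shows "\<exists>S E T b u v q l. skeleton S E T b u v q l \<and>
    (\<forall>K\<subseteq>skeleton.gaps b. words n (skeleton.bridged S E T b u v K) = V)"
proof -
  define cy where "cy s = (SOME p. cyclic p \<and> window n p 0 = s)" for s
  have cy: "cyclic (cy s)" "window n (cy s) 0 = s" if "minimal s \<or> maximal s" for s
  proof -
    have "\<exists>p. cyclic p \<and> window n p 0 = s" using that minimal_cyclic maximal_cyclic by metis
    then show "cyclic (cy s)" "window n (cy s) 0 = s" unfolding cy_def by (rule someI2_ex; simp)+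
  qed
  define S where "S = \<Union>(orbit ` cy ` {s. minimal s})"
  define E0 where "E0 = \<Union>(orbit ` cy ` {s. maximal s \<and> \<not> minimal s})"
  have VS: "{s. minimal s} \<subseteq> V" "{s. maximal s \<and> \<not> minimal s} \<subseteq> V"
    by (auto simp: minimal_def maximal_def)
  have orbit_finite: "finite (orbit p)" if "cyclic p" for p
    using that finite_orbit_periodic unfolding cyclic_def by blast
  have inv: "translate k p \<in> \<Union>(orbit ` A)" if "p \<in> \<Union>(orbit ` A)" for p k A
    using that orbit_translate by blast
  have finite_S: "finite S" and finite_E0: "finite E0"
    unfolding S_def E0_def image_image
    using VS[THEN finite_subset, OF finite_V] cy(1) orbit_finite by simp_all
  have S_inv: "translate k p \<in> S" if "p \<in> S" for p k using inv that unfolding S_def by blast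
  have E0_inv: "translate k p \<in> E0" if "p \<in> E0" for p k using inv that unfolding E0_def by blast
  have cyclic_orbit: "cyclic p" if "p \<in> orbit x" "cyclic x" for p x
    using that cyclic_translate by (auto simp: orbit_eq_range)
  have S: "cyclic p" "minimal (window n p 0)" if "p \<in> S" for p
  proof -
    obtain s k where s: "minimal s" "p = translate k (cy s)"
      using \<open>p \<in> S\<close> by (auto simp: S_def orbit_eq_range)
    then show "cyclic p" using cy cyclic_translate by blast
    show "minimal (window n p 0)"
      using minimal_equiv[OF s(1)] cyclic_reach[OF cy(1), of s k 0] cy(2)[of s] s by simp
  qed
  have E0: "cyclic p" "maximal (window n p 0)" "\<not> minimal (window n p 0)" if "p \<in> E0" for p
  proof -
    obtain s k where s: "maximal s" "\<not> minimal s" "p = translate k (cy s)"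
      using \<open>p \<in> E0\<close> by (auto simp: E0_def orbit_eq_range)
    then show "cyclic p" using cy cyclic_translate by blast
    have r: "reach (window n p 0) s" "reach s (window n p 0)"
      using cyclic_reach[OF cy(1), of s k 0] cyclic_reach[OF cy(1), of s 0 k] cy(2)[of s] s by auto
    show "maximal (window n p 0)" using maximal_equiv[OF s(1)] r by blast
    show "\<not> minimal (window n p 0)" using minimal_equiv r s(2) by blast
  qed
  have cy_S: "cy s \<in> S" if "minimal s" for s using that orbit_self unfolding S_def by blast
  have cy_E0: "cy s \<in> E0" if "maximal s" "\<not> minimal s" for s using that orbit_self unfolding E0_def by blast
  have disjoint0: "S \<inter> E0 = {}" using S(2) E0(3) by blast

  \<comment> \<open>The second half of the chain, together with the final set of sinks. The first half comes for free,
    since every word is reached from a minimal one.\<close>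
  have "\<exists>b c E. cyclic b \<and> c \<in> E \<and> reach (window n b 0) (window n c 0) \<and> b \<notin> S \<union> E \<and> E0 \<subseteq> E \<and>
      finite E \<and> (\<forall>p\<in>E. cyclic p) \<and> (\<forall>p\<in>E. \<forall>k. translate k p \<in> E) \<and> S \<inter> E = {}"
    using rich
  proof
    assume "\<exists>p. cyclic p \<and> \<not> minimal (window n p 0) \<and> \<not> maximal (window n p 0)"
    then obtain b where b: "cyclic b" "\<not> minimal (window n b 0)" "\<not> maximal (window n b 0)" by blast
    obtain s where s: "maximal s" "reach (window n b 0) s"
      using ex_maximal sft_window[OF cyclic_sft[OF b(1)]] by blast
    have "\<not> minimal s" using b(2) s(2) minimal_equiv by blast
    then have "cy s \<in> E0" "window n (cy s) 0 = s" using cy_E0 cy s by auto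
    moreover have "b \<notin> S \<union> E0" using b S(2) E0(2) by blast
    ultimately show ?thesis
      using b s finite_E0 E0(1) E0_inv disjoint0 by (intro exI[of _ b] exI[of _ "cy s"] exI[of _ E0]) auto
  next
    assume branching: "\<exists>p p'. cyclic p \<and> cyclic p' \<and> window n p 0 = window n p' 0 \<and> p \<noteq> p'"
    then obtain s where inf: "infinite {x. cyclic x \<and> window n x 0 = s}" and s: "s \<in> V"
    proof -
      obtain p p' where p: "cyclic p" "cyclic p'" "window n p 0 = window n p' 0" "p \<noteq> p'"
        using branching by blast
      show ?thesis
        by (rule that[of "window n p' 0"])
          (use infinitely_many_cyclic[OF p(1,2,4)] p sft_window[OF cyclic_sft[OF p(2)]] in auto)
    qed
    have new: "\<exists>x. cyclic x \<and> window n x 0 = s \<and> x \<notin> A" if "finite A" for A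
      using inf that finite_subset[of "{x. cyclic x \<and> window n x 0 = s}" A] by blast
    obtain c where c: "cyclic c" "window n c 0 = s" "c \<notin> S" using new[OF finite_S] by blast
    define E where "E = E0 \<union> orbit c"
    have finite_E: "finite E" using finite_E0 orbit_finite c by (simp add: E_def)
    obtain b where b: "cyclic b" "window n b 0 = s" "b \<notin> S \<union> E"
      using new[of "S \<union> E"] finite_S finite_E by blast
    have "S \<inter> orbit c = {}"
    proof (rule equals0I)
      fix x assume "x \<in> S \<inter> orbit c"
      then have "x \<in> S" "c \<in> orbit x" using orbit_sym by auto
      then obtain k where "c = translate k x" by (auto simp: orbit_eq_range)
      then show False using S_inv \<open>x \<in> S\<close> c(3) by simp
    qed
    then have "S \<inter> E = {}" using disjoint0 by (auto simp: E_def)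
    moreover have "\<forall>p\<in>E. cyclic p" using E0(1) cyclic_orbit c(1) by (auto simp: E_def)
    moreover have "\<forall>p\<in>E. \<forall>k. translate k p \<in> E" using E0_inv orbit_translate by (auto simp: E_def)
    moreover have "reach (window n b 0) (window n c 0)" using b c reach_refl[OF s] by simp
    moreover have "c \<in> E" "E0 \<subseteq> E" by (auto simp: E_def)
    ultimately show ?thesis using b finite_E by blast
  qed
  then obtain b c E where b: "cyclic b" "b \<notin> S \<union> E" and c: "c \<in> E" "reach (window n b 0) (window n c 0)"
    and E0E: "E0 \<subseteq> E" and E: "finite E" "\<And>p. p \<in> E \<Longrightarrow> cyclic p" "\<And>p k. p \<in> E \<Longrightarrow> translate k p \<in> E"
    and disjoint: "S \<inter> E = {}" by blast

  have "\<exists>q>0. \<forall>p\<in>S \<union> E \<union> {b}. \<forall>i. p (i + q) = p i"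
    using finite_S E(1,2) S(1) b(1) by (intro common_period) (auto simp: cyclic_def)
  then obtain q where q: "q > 0" "\<And>p i. p \<in> S \<union> E \<union> {b} \<Longrightarrow> p (i + q) = p i" by blast

  define V' where "V' = {s\<in>V. \<not> (minimal s \<and> maximal s)}"
  have "\<exists>t l. t \<in> sft \<and> l \<ge> 0 \<and> (\<exists>p\<in>S. \<forall>i<0. t i = p i) \<and> (\<exists>p\<in>E. \<forall>i\<ge>l. t i = p i) \<and> (\<exists>j. window n t j = s)"
    if s: "s \<in> V'" for s
  proof -
    obtain a d where a: "minimal a" "reach a s" and d: "maximal d" "reach s d"
      using s ex_minimal ex_maximal unfolding V'_def by blast
    have nmin: "\<not> minimal d"
    proof
      assume "minimal d"
      then have "minimal s" using d minimal_equiv by blast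
      moreover have "reach d s" using \<open>minimal d\<close> d(2) by (simp add: minimal_def)
      then have "maximal s" using maximal_equiv[OF d(1)] by blast
      ultimately show False using s by (simp add: V'_def)
    qed
    obtain t l where t: "t \<in> sft" "l \<ge> 0" "\<forall>k<0. t k = cy a k" "\<forall>k\<ge>l. t k = cy d (k - l)" "\<exists>j. window n t j = s"
      using connect[of "cy a" "cy d" s] cy[of a] cy[of d] a d cyclic_sft by auto
    have "translate (- l) (cy d) \<in> E" using E(3) E0E cy_E0[OF d(1) nmin] by blast
    moreover have "\<forall>k\<ge>l. t k = translate (- l) (cy d) k" using t(4) by simp
    ultimately show ?thesis using t cy_S[OF a(1)] by blast
  qed
  then obtain tr lt where tr: "\<And>s. s \<in> V' \<Longrightarrow> tr s \<in> sft \<and> lt s \<ge> 0 \<and> (\<exists>p\<in>S. \<forall>i<0. tr s i = p i) \<and>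
      (\<exists>p\<in>E. \<forall>i\<ge>lt s. tr s i = p i) \<and> (\<exists>j. window n (tr s) j = s)" by metis
  define T where "T = tr ` V'"

  obtain a where a: "minimal a" "reach a (window n b 0)"
    using ex_minimal sft_window[OF cyclic_sft[OF b(1)]] by blast
  have bV: "window n b 0 \<in> V" using sft_window[OF cyclic_sft[OF b(1)]] .
  obtain t lu where t: "t \<in> sft" "lu \<ge> 0" "\<forall>k<0. t k = cy a k" "\<forall>k\<ge>lu. t k = b (k - lu)"
    using connect[of "cy a" b "window n b 0"] cy[of a] a cyclic_sft b(1) reach_refl[OF bV] by auto
  obtain v lv where v: "v \<in> sft" "lv \<ge> 0" "\<forall>k<0. v k = b k" "\<forall>k\<ge>lv. v k = c (k - lv)"
    using connect[of b c "window n b 0"] c cyclic_sft b(1) E(2)[OF c(1)] reach_refl[OF bV] by auto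
  \<comment> \<open>With the delay \<open>m\<close> the transition \<open>u\<close> agrees with \<open>b\<close> already from time \<open>- n\<close> on. So a window of a bridge
    lies within \<open>u\<close> or within the delayed \<open>v\<close>, even if the gap is shorter than \<open>n\<close>.\<close>
  define m where "m = int n * q"
  have m: "m \<ge> int n" using q(1) mult_left_mono[of 1 q "int n"] by (simp add: m_def)
  define u where "u = translate (lu + m) t"
  have u_sft: "u \<in> sft" using t sft_translate by (simp add: u_def)
  have u_b: "u k = b k" if "k \<ge> - m" for k
  proof -
    have "u k = b (k + m)" using t(4) that by (simp add: u_def)
    also have "\<dots> = b k" unfolding m_def by (rule periodic_mult) (use q in auto)
    finally show ?thesis .
  qed
  have u_a: "u k = translate (lu + m) (cy a) k" if "k < - (lu + m)" for k
    using t(3) that by (simp add: u_def)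
  define l where "l = Max (insert (lu + m) (insert lv (lt ` V')))"
  have fin: "finite (insert (lu + m) (insert lv (lt ` V')))" using finite_V by (simp add: V'_def)
  have l: "lu + m \<le> l" "lv \<le> l" "\<And>s. s \<in> V' \<Longrightarrow> lt s \<le> l"
    unfolding l_def by (rule Max_ge[OF fin], simp)+

  have sk: "skeleton S E T b u v q l"
  proof
    show "finite T" using finite_V by (simp add: T_def V'_def)
    show "l \<ge> 0" using l(2) v(2) by simp
    show "\<exists>p\<in>S. \<forall>i<0. t i = p i" if "t \<in> T" for t using that tr by (auto simp: T_def)
    show "\<exists>p\<in>E. \<forall>i\<ge>l. t i = p i" if t: "t \<in> T" for t
    proof -
      obtain s where "s \<in> V'" "t = tr s" using t by (auto simp: T_def)
      then obtain p where "p \<in> E" "\<forall>i\<ge>lt s. t i = p i" "lt s \<le> l" using tr l(3) by blast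
      then show ?thesis by (intro bexI[of _ p]) auto
    qed
    have "translate (lu + m) (cy a) \<in> S" using S_inv cy_S a by blast
    then show "\<exists>p\<in>S. \<forall>i< - l. u i = p i" using u_a l(1) by (intro bexI) auto
    have "translate (- lv) c \<in> E" using E(3) c by blast
    then show "\<exists>p\<in>E. \<forall>i\<ge>l. v i = p i" using v(4) l(2) by (intro bexI) auto
    show "u i = b i" if "0 \<le> i" for i using u_b that m by simp
  qed (use finite_S E q S_inv disjoint b v in auto)
  interpret sk: skeleton S E T b u v q l by (rule sk)
  have bridge_sft: "sk.bridge g \<in> sft" if g: "g \<in> sk.gaps" for g
    unfolding sft_def
  proof (intro CollectI allI)
    fix i
    consider "i + int n \<le> int g" | "i \<ge> - int n" by linarith
    then show "window n (sk.bridge g) i \<in> V"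
    proof cases
      case 1
      then show ?thesis using sk.bridge_window(1)[OF g] sft_window[OF u_sft] by simp
    next
      case 2
      have "sk.bridge g k = v (k - int g)" if "k \<ge> - int n" for k
        using that m u_b[of k] v(3) sk.b_gap[OF g, of k] by (auto simp: sk.bridge_def)
      then have "window n (sk.bridge g) i = window n v (i - int g)"
        using 2 by (intro window_eqI) (simp add: algebra_simps)
      then show ?thesis using sft_window[OF v(1)] by simp
    qed
  qed
  have "words n (sk.bridged K) = V" if K: "K \<subseteq> sk.gaps" for K
  proof
    have "y \<in> sft" if "y \<in> sk.bridged K" for y
      using that
    proof (cases rule: sk.bridged_cases)
      case 1
      then show ?thesis using S(1) E(2) b(1) cyclic_orbit cyclic_sft by (auto simp: sk.P_def)
    next
      case (2 t k)
      then show ?thesis using sft_translate u_sft v(1) tr by (auto simp: T_def)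
    next
      case (3 g k)
      then show ?thesis using sft_translate bridge_sft K by blast
    qed
    then show "words n (sk.bridged K) \<subseteq> V" using sft_window by (auto simp: words_alt)
    show "V \<subseteq> words n (sk.bridged K)"
    proof
      fix s assume s: "s \<in> V"
      show "s \<in> words n (sk.bridged K)"
      proof (cases "s \<in> V'")
        case True
        then obtain j where "window n (tr s) j = s" using tr by blast
        moreover have "tr s \<in> sk.bridged K"
          using sk.orbit_subset_bridged(1)[of "tr s" 0] True by (simp add: T_def)
        ultimately show ?thesis using window_in_words by metis
      next
        case False
        then have "minimal s" using s by (simp add: V'_def)
        then have "cy s \<in> sk.bridged K" "window n (cy s) 0 = s"
          using cy_S[of s] cy(2)[of s] sk.P_subset_bridged[of K] unfolding sk.P_def by blast+
        then show ?thesis using window_in_words by metis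
      qed
    qed
  qed
  then show ?thesis using sk by blast
qed

end

text \<open>If the shift of finite type were a finite union of orbits, each subshift in it would be a union of
  some of these, and only finitely many subshifts would have the words of \<open>X\<close>.\<close>

lemma nonisolated_skeleton:
  assumes X: "X \<in> nonisolated"
  shows "\<exists>S E T b u v q l. skeleton S E T b u v q l \<and>
    (\<forall>K\<subseteq>skeleton.gaps b. words n (skeleton.bridged S E T b u v K) = words n X)"
proof -
  have sub: "subshift X" using X by (rule nonisolated_subshift)
  interpret word_graph "words (Suc n) X" "Suc n"
  proof
    fix s assume "s \<in> words (Suc n) X"
    then obtain z where "z \<in> X" "window (Suc n) z 0 = s" by (rule word_occurs_at[OF sub])
    then show "\<exists>z. (\<forall>i. window (Suc n) z i \<in> words (Suc n) X) \<and> window (Suc n) z 0 = s"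
      using window_in_words by blast
  qed (use finite_words[OF sub] in auto)
  have "\<not> (\<exists>F. finite F \<and> sft \<subseteq> \<Union>(orbit ` F))"
  proof
    assume "\<exists>F. finite F \<and> sft \<subseteq> \<Union>(orbit ` F)"
    then obtain F where F: "finite F" "sft \<subseteq> \<Union>(orbit ` F)" by blast
    have "Z \<in> (\<lambda>A. \<Union>(orbit ` A)) ` Pow F" if Z: "subshift Z" "words (Suc n) Z = words (Suc n) X" for Z
    proof (rule image_eqI)
      have orb: "orbit z \<subseteq> Z" if "z \<in> Z" for z
        using translate_in_subshift[OF Z(1) that] by (auto simp: orbit_eq_range)
      have "Z \<subseteq> sft" using window_in_words[of _ Z] Z(2) by (auto simp: sft_def)
      have "z \<in> \<Union>(orbit ` (Z \<inter> F))" if z: "z \<in> Z" for z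
      proof -
        obtain f where "f \<in> F" "z \<in> orbit f" using F(2) \<open>Z \<subseteq> sft\<close> z by blast
        moreover from this have "f \<in> Z" using orbit_sym orb[OF z] by blast
        ultimately show ?thesis by blast
      qed
      then show "Z = \<Union>(orbit ` (Z \<inter> F))" using orb by blast
    qed auto
    then have "{Z. subshift Z \<and> words (Suc n) Z = words (Suc n) X} \<subseteq> (\<lambda>A. \<Union>(orbit ` A)) ` Pow F" by blast
    then have "finite {Z. subshift Z \<and> words (Suc n) Z = words (Suc n) X}"
      using F(1) finite_subset by blast
    then show False using nonisolated_infinite[OF X] by blast
  qed
  then have "(\<exists>p. cyclic p \<and> \<not> minimal (window (Suc n) p 0) \<and> \<not> maximal (window (Suc n) p 0)) \<or>
    (\<exists>p p'. cyclic p \<and> cyclic p' \<and> window (Suc n) p 0 = window (Suc n) p' 0 \<and> p \<noteq> p')"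
    using finitely_many_orbits by blast
  from skeleton_exists[OF this] show ?thesis
    using words_eq_shorter[of "Suc n" _ X n] by (meson le_SucI order_refl)
qed

section \<open>Generic subshifts\<close>

context skeleton
begin

lemma infinite_gaps: "infinite gaps"
  using gaps_unbounded by (metis finite_nat_set_iff_bounded not_less_iff_gr_or_eq)

text \<open>Choose the elements \<open>g 0 < g 1 < \<dots>\<close> of \<open>K\<close> so that \<open>f (g j)\<close> exceeds \<open>2 * growth + j\<close>. At \<open>n = g j\<close> only \<open>j\<close> bridges
  are shorter than \<open>n\<close>, and the complexity is at most \<open>growth * Suc n + j * n\<close>.\<close>

lemma sparse_bridges:
  fixes f :: "nat \<Rightarrow> real"
  assumes f: "mono f" "\<not> bounded (range f)"
  obtains K where "K \<subseteq> gaps" "infinite K"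
    "\<And>N. \<exists>n\<ge>N. real (complexity (bridged K) n) < real n * f n"
proof -
  have large: "\<exists>n. \<forall>m\<ge>n. c < f m" for c
  proof -
    have "\<exists>n. c < f n"
    proof (rule ccontr)
      assume "\<nexists>n. c < f n"
      then have "range f \<subseteq> {f 0..c}" using f(1) by (auto simp: not_less mono_def)
      then show False using f(2) bounded_subset bounded_closed_interval by metis
    qed
    then show ?thesis using f(1) by (meson less_le_trans monoD)
  qed
  have step: "\<exists>g. (g \<in> gaps \<and> 2 * real growth + real j < f g) \<and> h < g" for j h
  proof -
    obtain n where n: "\<And>m. m \<ge> n \<Longrightarrow> 2 * real growth + real j < f m" using large by blast
    obtain g where "g \<in> gaps" "max n h < g" using gaps_unbounded by blast
    then show ?thesis using n[of g] by (intro exI[of _ g]) auto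
  qed
  have "\<exists>g. \<forall>j. (g j \<in> gaps \<and> 2 * real growth + real j < f (g j)) \<and> g j < g (Suc j)"
    using step by (intro dependent_nat_choice) blast+
  then obtain g where g: "\<And>j. g j \<in> gaps" "\<And>j. 2 * real growth + real j < f (g j)" "\<And>j. g j < g (Suc j)"
    by blast
  have mono: "strict_mono g" using g(3) by (simp add: strict_mono_Suc_iff)
  have K: "range g \<subseteq> gaps" using g(1) by blast
  have "real (complexity (bridged (range g)) (g j)) < real (g j) * f (g j)" if "j > 0" for j
  proof -
    have "{h \<in> range g. h < g j} = g ` {..<j}"
      using mono by (auto simp: strict_mono_less)
    then have card: "card {h \<in> range g. h < g j} = j"
      using strict_mono_imp_inj_on[OF mono] by (simp add: card_image inj_on_subset)
    have pos: "g j \<ge> 1" using strict_mono_imp_increasing[OF mono, of j] that by linarith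
    have "complexity (bridged (range g)) (g j) \<le> growth * Suc (g j) + j * g j"
      using complexity_bridged_le[OF K, of "g j"] card by simp
    also have "\<dots> \<le> g j * (2 * growth + j)"
      using mult_left_mono[OF pos, of growth] by (simp add: algebra_simps)
    finally have "real (complexity (bridged (range g)) (g j)) \<le> real (g j * (2 * growth + j))"
      by (rule of_nat_mono)
    also have "\<dots> = real (g j) * (2 * real growth + real j)" by simp
    also have "\<dots> < real (g j) * f (g j)" using g(2) pos by (intro mult_strict_left_mono) auto
    finally show ?thesis .
  qed
  then have "\<exists>n\<ge>N. real (complexity (bridged (range g)) n) < real n * f n" for N
    using strict_mono_imp_increasing[OF mono, of "Suc N"] by (intro exI[of _ "g (Suc N)"]) auto
  moreover have "infinite (range g)"
    using strict_mono_imp_inj_on[OF mono] range_inj_infinite by blast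
  ultimately show ?thesis using that K by blast
qed

text \<open>These properties hold for \<open>bridged gaps\<close> and pass to subsets.\<close>

lemma bridged_hereditary:
  assumes Z: "Z \<subseteq> bridged gaps"
  shows "countable Z" "\<exists>\<P>. finite \<P> \<and> (\<forall>P\<in>\<P>. periodic_orbit P) \<and> (\<forall>x\<in>Z. bi_asymptotic x \<P>)"
    "\<exists>C D E :: real. \<forall>n. real (complexity Z n) \<le> C * real n ^ 2 + D * real n + E"
proof -
  show "countable Z" using Z countable_bridged countable_subset by blast
  have "finite (orbit ` P)" "\<forall>A\<in>orbit ` P. periodic_orbit A" "\<forall>x\<in>Z. bi_asymptotic x (orbit ` P)"
    using finite_P P_periodic_orbits bridged_bi_asymptotic[OF order_refl] Z by auto
  then show "\<exists>\<P>. finite \<P> \<and> (\<forall>P\<in>\<P>. periodic_orbit P) \<and> (\<forall>x\<in>Z. bi_asymptotic x \<P>)" by blast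
  have "real (complexity Z n) \<le> 1 * real n ^ 2 + real growth * real n + real growth" for n
  proof -
    have "complexity Z n \<le> complexity (bridged gaps) n"
      using Z subshift_bridged by (intro complexity_mono) auto
    also have "\<dots> \<le> growth * Suc n + card {g\<in>gaps. g < n} * n"
      by (rule complexity_bridged_le) simp
    also have "\<dots> \<le> growth * Suc n + n * n"
      using card_mono[of "{..<n}" "{g\<in>gaps. g < n}"] by auto
    finally have "real (complexity Z n) \<le> real (growth * Suc n + n * n)" by linarith
    then show ?thesis by (simp add: algebra_simps power2_eq_square)
  qed
  then show "\<exists>C D E :: real. \<forall>n. real (complexity Z n) \<le> C * real n ^ 2 + D * real n + E" by blast
qed

end

lemma infinite_if_complexity_unbounded:
  assumes "subshift Z" "\<And>n. real n - c \<le> real (complexity Z n)"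
  shows "infinite Z"
proof
  assume "finite Z"
  then have bound: "complexity Z n \<le> card Z" for n
    unfolding complexity_def words_subshift[OF assms(1)] by (rule card_image_le)
  obtain n where "real n > c + real (card Z)" using reals_Archimedean2 by blast
  then show False using assms(2)[of n] bound[of n] by linarith
qed

lemma superlinearI:
  fixes a :: "nat \<Rightarrow> nat"
  assumes "\<And>k::nat. \<exists>c. \<forall>n. real k * (real n - c) \<le> real (a n)"
  shows "filterlim (\<lambda>n. real (a n) / real n) at_top sequentially"
  unfolding filterlim_at_top
proof
  fix B :: real
  obtain k :: nat where k: "real k > \<bar>B\<bar> + 1" using reals_Archimedean2 by blast
  obtain c where c: "\<And>n. real k * (real n - c) \<le> real (a n)" using assms by blast
  obtain m :: nat where m: "real m > real k * \<bar>c\<bar>" using reals_Archimedean2 by blast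
  show "\<forall>\<^sub>F n in sequentially. B \<le> real (a n) / real n"
  proof (rule eventually_sequentiallyI[of "Suc m"])
    fix n assume n: "Suc m \<le> n"
    have "(\<bar>B\<bar> + 1) * real n \<le> real k * real n" using k by (intro mult_right_mono) auto
    moreover have "real k * c \<le> real n"
    proof -
      have "real k * c \<le> real k * \<bar>c\<bar>" by (intro mult_left_mono) auto
      then show ?thesis using m n by linarith
    qed
    moreover have "B * real n \<le> \<bar>B\<bar> * real n" by (intro mult_right_mono) auto
    ultimately have "B * real n \<le> real (a n)" using c[of n] by (simp add: algebra_simps)
    then show "B \<le> real (a n) / real n" using n by (simp add: field_simps)
  qed
qed

theorem theorem1p2:
  shows "generic derived_subshift_space (\<lambda>X.
           (countable X \<and> infinite X \<and>
            (\<exists>\<P>. finite \<P> \<and> (\<forall>P\<in>\<P>. periodic_orbit P) \<and> (\<forall>x\<in>X. bi_asymptotic x \<P>))) \<and>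
           (filterlim (\<lambda>n. real (complexity X n) / real n) at_top sequentially \<and>
            (\<exists>C D E :: real. \<forall>n. real (complexity X n) \<le> C * real n ^ 2 + D * real n + E)))
         \<and>
         (\<forall>f :: nat \<Rightarrow> real. mono f \<longrightarrow> \<not> bounded (range f) \<longrightarrow>
            generic derived_subshift_space
              (\<lambda>X. infinite {n. real (complexity X n) < real n * f n}))"
proof (intro conjI allI impI)
  define tame where "tame Z \<longleftrightarrow> countable Z \<and>
    (\<exists>\<P>. finite \<P> \<and> (\<forall>P\<in>\<P>. periodic_orbit P) \<and> (\<forall>x\<in>Z. bi_asymptotic x \<P>)) \<and>
    (\<exists>C D E :: real. \<forall>n. real (complexity Z n) \<le> C * real n ^ 2 + D * real n + E)"
    for Z :: "(int \<Rightarrow> int) set"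
  let ?Q = "\<lambda>(k::nat) Z. tame Z \<and> (\<exists>c. \<forall>n. real k * (real n - c) \<le> real (complexity Z n))"
  show "generic derived_subshift_space (\<lambda>X.
           (countable X \<and> infinite X \<and>
            (\<exists>\<P>. finite \<P> \<and> (\<forall>P\<in>\<P>. periodic_orbit P) \<and> (\<forall>x\<in>X. bi_asymptotic x \<P>))) \<and>
           (filterlim (\<lambda>n. real (complexity X n) / real n) at_top sequentially \<and>
            (\<exists>C D E :: real. \<forall>n. real (complexity X n) \<le> C * real n ^ 2 + D * real n + E)))"
  proof (rule generic_derivedI[where Q = ?Q])
    fix X n assume "X \<in> nonisolated"
    then obtain S E T b u v q l where sk: "skeleton S E T b u v q l"
      and w: "\<forall>K\<subseteq>skeleton.gaps b. words n (skeleton.bridged S E T b u v K) = words n X"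
      using nonisolated_skeleton by metis
    interpret skeleton S E T b u v q l by (rule sk)
    have "\<exists>m. \<forall>Z\<in>nonisolated. words m Z = words m (bridged gaps) \<longrightarrow> ?Q k Z" for k
      using nearby_superlinear[OF order_refl infinite_gaps, of k] bridged_hereditary nonisolated_subshift
      unfolding tame_def by meson
    then show "\<exists>Y\<in>nonisolated. words n Y = words n X \<and>
        (\<forall>k. \<exists>m. \<forall>Z\<in>nonisolated. words m Z = words m Y \<longrightarrow> ?Q k Z)"
      using w bridged_nonisolated[OF order_refl infinite_gaps] by blast
  next
    fix Z assume Z: "Z \<in> nonisolated" and Q: "\<And>k. ?Q k Z"
    obtain c where "\<And>n. real 1 * (real n - c) \<le> real (complexity Z n)" using Q[of 1] by blast
    then have "infinite Z"
      by (intro infinite_if_complexity_unbounded[OF nonisolated_subshift[OF Z], of c]) simp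
    moreover have "filterlim (\<lambda>n. real (complexity Z n) / real n) at_top sequentially"
      using Q by (intro superlinearI) blast
    moreover have "tame Z" using Q[of 0] by blast
    ultimately show "(countable Z \<and> infinite Z \<and>
            (\<exists>\<P>. finite \<P> \<and> (\<forall>P\<in>\<P>. periodic_orbit P) \<and> (\<forall>x\<in>Z. bi_asymptotic x \<P>))) \<and>
           (filterlim (\<lambda>n. real (complexity Z n) / real n) at_top sequentially \<and>
            (\<exists>C D E :: real. \<forall>n. real (complexity Z n) \<le> C * real n ^ 2 + D * real n + E))"
      unfolding tame_def by blast
  qed
  fix f :: "nat \<Rightarrow> real" assume f: "mono f" "\<not> bounded (range f)"
  show "generic derived_subshift_space (\<lambda>X. infinite {n. real (complexity X n) < real n * f n})"
  proof (rule generic_derivedI[where Q = "\<lambda>k Z. \<exists>n\<ge>k. real (complexity Z n) < real n * f n"])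
    fix X n assume "X \<in> nonisolated"
    then obtain S E T b u v q l where sk: "skeleton S E T b u v q l"
      and w: "\<forall>K\<subseteq>skeleton.gaps b. words n (skeleton.bridged S E T b u v K) = words n X"
      using nonisolated_skeleton by metis
    interpret skeleton S E T b u v q l by (rule sk)
    obtain K where K: "K \<subseteq> gaps" "infinite K"
      and low: "\<And>N. \<exists>n\<ge>N. real (complexity (bridged K) n) < real n * f n"
      using sparse_bridges[OF f] by metis
    have "\<exists>m. \<forall>Z\<in>nonisolated. words m Z = words m (bridged K) \<longrightarrow>
        (\<exists>n\<ge>k. real (complexity Z n) < real n * f n)" for k
      using low[of k] unfolding complexity_def by metis
    then show "\<exists>Y\<in>nonisolated. words n Y = words n X \<and>
        (\<forall>k. \<exists>m. \<forall>Z\<in>nonisolated. words m Z = words m Y \<longrightarrow>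
          (\<exists>n\<ge>k. real (complexity Z n) < real n * f n))"
      using w K bridged_nonisolated[OF K] by blast
  next
    fix Z assume "\<And>k. \<exists>n\<ge>k. real (complexity Z n) < real n * f n"
    then show "infinite {n. real (complexity Z n) < real n * f n}"
      by (simp add: infinite_nat_iff_unbounded_le)
  qed
qed

end
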